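(* Let $p\ge 2$ be an integer, let $D\subset\mathbb{Z}^2$ be a finite digit set, and let $M\in M_2(\mathbb{Z})$ be an expanding integer matrix. Suppose that $\emptyset\neq\mathcal{Z}_D^2\subset\mathring{E}_p^2$ and $\gcd(\det(M),p)=1$. Then there exist at most $p^2$ mutually orthogonal exponential functions in $L^2(\mu_{M,D})$; that is, if $\Lambda\subset\mathbb{R}^2$ is such that the functions $e^{2\pi i\langle\lambda,x\rangle}$, $\lambda\in\Lambda$, are mutually orthogonal in $L^2(\mu_{M,D})$, then $\#\Lambda\le p^2$. In particular, if $p$ is a prime, then the number $p^2$ is best possible: for every finite $D\subset\mathbb{Z}^2$ with $\emptyset\neq\mathcal{Z}_D^2\subset\mathring{E}_p^2$ there is an expanding matrix $M\in M_2(\mathbb{Z})$ with $\gcd(\det(M),p)=1$ such that $L^2(\mu_{M,D})$ contains $p^2$ mutually orthogonal exponential functions.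
   Context: A real square matrix is expanding if all its eigenvalues have modulus $>1$. For an expanding matrix $M\in M_2(\mathbb{R})$ and a finite set $D\subset\mathbb{R}^2$ with cardinality $\#(D)$, put $\phi_d(x)=M^{-1}(x+d)$ for $x\in\mathbb{R}^2$, $d\in D$. The self-affine measure $\mu_{M,D}$ is the unique Borel probability measure $\mu$ on $\mathbb{R}^2$ satisfying $\mu=\frac{1}{\#(D)}\sum_{d\in D}\mu\circ\phi_d^{-1}$. For an integer $p\ge2$: $E_p^2:=\frac1p\{(l_1,l_2)^t: l_1,l_2\in\mathbb{Z},\ 0\le l_1,l_2\le p-1\}$ and $\mathring{E}_p^2:=E_p^2\setminus\{0\}$. For a finite $D\subset\mathbb{Z}^2$: $m_D(x)=\frac{1}{\#(D)}\sum_{d\in D}e^{2\pi i\langle d,x\rangle}$ for $x\in\mathbb{R}^2$, and $\mathcal{Z}_D^2:=\{x\in[0,1)^2: m_D(x)=0\}$. An exponential function is a function $x\mapsto e^{2\pi i\langle\lambda,x\rangle}$ with $\lambda\in\mathbb{R}^2$; a family indexed by $\Lambda\subset\mathbb{R}^2$ is mutually orthogonal if the functions corresponding to any two distinct elements of $\Lambda$ are orthogonal in $L^2(\mu_{M,D})$. *)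

theory Defs
  imports "HOL-Probability.Probability" "HOL-Computational_Algebra.Primes"
begin

(* Eigenvalues are the complex ones: the real matrix is viewed over the complex numbers. *)
definition expanding :: "real ^ 'n ^ 'n \<Rightarrow> bool" where
  "expanding M \<longleftrightarrow>
     (\<forall>z::complex. (\<exists>v::complex ^ 'n. v \<noteq> 0 \<and> map_matrix complex_of_real M *v v = z *s v)
        \<longrightarrow> cmod z > 1)"

definition real_vec :: "int ^ 2 \<Rightarrow> real ^ 2" where
  "real_vec d = (\<chi> i. real_of_int (d $ i))"

abbreviation real_mat :: "int ^ 2 ^ 2 \<Rightarrow> real ^ 2 ^ 2" where
  "real_mat M \<equiv> map_matrix real_of_int M"

definition ifs_map :: "real ^ 2 ^ 2 \<Rightarrow> real ^ 2 \<Rightarrow> real ^ 2 \<Rightarrow> real ^ 2" where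
  "ifs_map M d x = matrix_inv M *v (x + d)"

definition is_self_affine_measure ::
    "real ^ 2 ^ 2 \<Rightarrow> (real ^ 2) set \<Rightarrow> (real ^ 2) measure \<Rightarrow> bool" where
  "is_self_affine_measure M D \<mu> \<longleftrightarrow>
     prob_space \<mu> \<and> sets \<mu> = sets borel \<and>
     (\<forall>A\<in>sets borel.
        measure \<mu> A = 1 / real (card D) * (\<Sum>d\<in>D. measure \<mu> (ifs_map M d -` A)))"

(* Meaningful for expanding M and finite nonempty D, where existence and uniqueness hold
   by Hutchinson's theorem. *)
definition self_affine_measure :: "real ^ 2 ^ 2 \<Rightarrow> (real ^ 2) set \<Rightarrow> (real ^ 2) measure" where
  "self_affine_measure M D = (THE \<mu>. is_self_affine_measure M D \<mu>)"

definition E_set :: "nat \<Rightarrow> (real ^ 2) set" where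
  "E_set p = {(1 / real p) *\<^sub>R real_vec l | l. \<forall>i. 0 \<le> l $ i \<and> l $ i \<le> int p - 1}"

definition E_ring :: "nat \<Rightarrow> (real ^ 2) set" where
  "E_ring p = E_set p - {0}"

definition exp_fun :: "real ^ 2 \<Rightarrow> real ^ 2 \<Rightarrow> complex" where
  "exp_fun \<xi> x = exp (2 * complex_of_real pi * \<i> * complex_of_real (\<xi> \<bullet> x))"

definition mask :: "(int ^ 2) set \<Rightarrow> real ^ 2 \<Rightarrow> complex" where
  "mask D x = 1 / of_nat (card D) * (\<Sum>d\<in>D. exp_fun (real_vec d) x)"

definition Z_set :: "(int ^ 2) set \<Rightarrow> (real ^ 2) set" where
  "Z_set D = {x. (\<forall>i. 0 \<le> x $ i \<and> x $ i < 1) \<and> mask D x = 0}"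

definition L2_inner :: "(real ^ 2) measure \<Rightarrow> (real ^ 2 \<Rightarrow> complex) \<Rightarrow> (real ^ 2 \<Rightarrow> complex) \<Rightarrow> complex" where
  "L2_inner \<mu> f g = (\<integral>x. f x * cnj (g x) \<partial>\<mu>)"

(* Exponentials are bounded and continuous, so they lie in L^2 of every Borel probability
   measure and the integral defining their inner product converges. *)
definition mutually_orthogonal_exps :: "(real ^ 2) measure \<Rightarrow> (real ^ 2) set \<Rightarrow> bool" where
  "mutually_orthogonal_exps \<mu> \<Lambda> \<longleftrightarrow>
     pairwise (\<lambda>a b. L2_inner \<mu> (exp_fun a) (exp_fun b) = 0) \<Lambda>"

end

theory Submission
  imports Defs "HOL-Algebra.Multiplicative_Group" "HOL-Number_Theory.Cong"
begin

text \<open>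
  Let \<open>B\<close> be the transpose of \<open>M\<close> inverse. Invariance of the measure turns into the functional equation
  \<open>F \<xi> = mask D (B \<xi>) * F (B \<xi>)\<close> for its Fourier transform \<open>F\<close>; as \<open>B ^ n \<xi>\<close> tends to \<open>0\<close> and \<open>F 0 = 1\<close>,
  \<open>F \<xi>\<close> vanishes iff the mask vanishes at some \<open>B ^ n \<xi>\<close> with \<open>n \<ge> 1\<close>. The zeros of the mask lie in
  \<open>1/p (Z\<^sup>2 - p Z\<^sup>2)\<close>, which is stable under the transpose of \<open>M\<close> because \<open>det M\<close> is prime to \<open>p\<close>. Hence
  differences of orthogonal frequencies are \<open>1/p\<close> times integer vectors that are nonzero modulo \<open>p\<close>, and there
  are only \<open>p\<^sup>2\<close> residue classes. For prime \<open>p\<close>, multiplication by a generator of the unit group of the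
  field with \<open>p\<^sup>2\<close> elements is a matrix \<open>N\<close> whose powers act transitively on the nonzero vectors modulo
  \<open>p\<close> (a Singer cycle). It lifts to an integer matrix with expanding transpose \<open>M\<close>, and the
  frequencies \<open>1/p N ^ K v\<close>, with \<open>v\<close> running over residues and \<open>K\<close> large, are orthogonal.
\<close>

section \<open>Expanding matrices\<close>

text \<open>Summing the recurrence bounds each partial sum by \<open>a 0\<close> plus
  \<open>r\<close> times itself plus a partial sum of \<open>s\<close>; as \<open>r < 1\<close>,
  this can be solved for the partial sum.\<close>

lemma summable_of_contracting_recurrence:
  fixes a s :: "nat \<Rightarrow> real"
  assumes nonneg: "\<And>n. 0 \<le> a n" "\<And>n. 0 \<le> s n" and r: "0 \<le> r" "r < 1" and s: "summable s"
    and step: "\<And>n. a (Suc n) \<le> r * a n + s n"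
  shows "summable a"
proof (rule summableI_nonneg_bounded)
  show "0 \<le> a n" for n by (rule nonneg)
  show "sum a {..<n} \<le> (a 0 + suminf s) / (1 - r)" for n
  proof -
    have le: "sum a {..<n} \<le> a 0 + r * sum a {..<n} + sum s {..<n}" for n
    proof (cases n)
      case (Suc m)
      have "sum a {..<Suc m} = a 0 + (\<Sum>k<m. a (Suc k))" by (rule sum.lessThan_Suc_shift)
      also have "\<dots> \<le> a 0 + (\<Sum>k<m. r * a k + s k)" by (intro add_left_mono sum_mono step)
      also have "\<dots> = a 0 + r * sum a {..<m} + sum s {..<m}"
        by (simp add: sum.distrib sum_distrib_left)
      also have "\<dots> \<le> a 0 + r * sum a {..<Suc m} + sum s {..<Suc m}"
        using nonneg r by (simp add: add_mono mult_left_mono)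
      finally show ?thesis by (simp add: Suc)
    qed (simp add: nonneg)
    have "sum s {..<n} \<le> suminf s" by (rule sum_le_suminf) (auto simp: s nonneg)
    then have "sum a {..<n} * (1 - r) \<le> a 0 + suminf s"
      using le[of n] by (simp add: algebra_simps)
    then show ?thesis using r by (simp add: pos_le_divide_eq)
  qed
qed

text \<open>The second-order recurrence splits into two first-order ones: \<open>w\<close> is
  geometric with ratio \<open>m\<close>, and \<open>y\<close> has ratio \<open>l\<close> with
  forcing \<open>w\<close>. This also covers a double root \<open>l = m\<close>.\<close>

lemma summable_linear_recurrence:
  fixes y :: "nat \<Rightarrow> complex"
  assumes rec: "\<And>n. y (Suc (Suc n)) = (l + m) * y (Suc n) - l * m * y n"
    and "cmod l < 1" "cmod m < 1"
  shows "summable (\<lambda>n. cmod (y n))"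
proof -
  define w where "w n = y (Suc n) - l * y n" for n
  have w: "w n = m ^ n * w 0" for n
  proof (induction n)
    case (Suc n)
    have "w (Suc n) = m * w n" unfolding w_def rec by (simp add: algebra_simps)
    then show ?case using Suc by simp
  qed simp
  have "summable (\<lambda>n. cmod (w n))"
    by (subst w) (simp add: norm_mult norm_power assms summable_mult2 summable_geometric)
  moreover have "cmod (y (Suc n)) \<le> cmod l * cmod (y n) + cmod (w n)" for n
    using norm_triangle_ineq[of "l * y n" "w n"] by (simp add: w_def norm_mult)
  ultimately show ?thesis
    using summable_of_contracting_recurrence[of "\<lambda>n. cmod (y n)" "\<lambda>n. cmod (w n)" "cmod l"] assms
    by simp
qed

lemma eigenvector_2:
  fixes A :: "complex ^ 2 ^ 2"
  assumes "z\<^sup>2 - (A $ 1 $ 1 + A $ 2 $ 2) * z + det A = 0"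
  shows "\<exists>v. v \<noteq> 0 \<and> A *v v = z *s v"
proof -
  have "det (A - mat z) = 0"
    using assms by (simp add: det_2 mat_def power2_eq_square algebra_simps)
  then have "\<not> (\<exists>B. B ** (A - mat z) = mat 1)"
    by (metis det_I det_mul mult_zero_right zero_neq_one)
  then obtain v where v: "(A - mat z) *v v = 0" "v \<noteq> 0"
    using matrix_left_invertible_ker by blast
  have "mat z *v v = z *s v"
    by (simp add: vec_eq_iff matrix_vector_mult_def sum_2 forall_2 mat_def)
  then have "A *v v = z *s v" using v(1) by (simp add: matrix_vector_mult_diff_rdistrib)
  with v(2) show ?thesis by blast
qed

lemma complex_quadratic_roots:
  fixes t d :: complex
  obtains l m where "l + m = t" "l * m = d"
proof
  show "(t + csqrt (t\<^sup>2 - 4 * d)) / 2 + (t - csqrt (t\<^sup>2 - 4 * d)) / 2 = t"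
    by (simp add: field_simps)
  have "((t + csqrt (t\<^sup>2 - 4 * d)) / 2) * ((t - csqrt (t\<^sup>2 - 4 * d)) / 2)
      = (t\<^sup>2 - (csqrt (t\<^sup>2 - 4 * d))\<^sup>2) / 4" by (simp add: field_simps power2_eq_square)
  then show "((t + csqrt (t\<^sup>2 - 4 * d)) / 2) * ((t - csqrt (t\<^sup>2 - 4 * d)) / 2) = d"
    by simp
qed

lemma matrix_inv_inverse:
  fixes M :: "'a::field ^ 'n ^ 'n"
  assumes "det M \<noteq> 0"
  shows "M *v (matrix_inv M *v x) = x" "matrix_inv M *v (M *v x) = x"
proof -
  have "\<exists>A. M ** A = mat 1 \<and> A ** M = mat 1"
    using assms invertible_det_nz[of M] unfolding invertible_def by blast
  then have "M ** matrix_inv M = mat 1 \<and> matrix_inv M ** M = mat 1"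
    unfolding matrix_inv_def by (rule someI_ex)
  then show "M *v (matrix_inv M *v x) = x" "matrix_inv M *v (M *v x) = x"
    by (simp_all add: matrix_vector_mul_assoc)
qed

lemma cayley_hamilton_2:
  fixes M :: "'a::comm_ring_1 ^ 2 ^ 2"
  shows "M *v (M *v u) = (M $ 1 $ 1 + M $ 2 $ 2) *s (M *v u) - det M *s u"
  by (simp add: vec_eq_iff matrix_vector_mult_def sum_2 forall_2 det_2 algebra_simps)

text \<open>By Cayley-Hamilton a backward orbit of \<open>M\<close> obeys a linear recurrence with
  characteristic roots \<open>1 / l\<close> and \<open>1 / m\<close>, where \<open>l\<close> and
  \<open>m\<close> are the eigenvalues of \<open>M\<close>. Both roots have modulus less than
  1.\<close>

lemma expanding_det_nz_and_summable:
  fixes M :: "real ^ 2 ^ 2"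
  assumes "expanding M"
  shows "det M \<noteq> 0" "summable (\<lambda>n. norm ((((*v) (matrix_inv M)) ^^ n) x))"
proof -
  define T where "T = M $ 1 $ 1 + M $ 2 $ 2"
  define C where "C = map_matrix complex_of_real M"
  have C: "complex_of_real T = C $ 1 $ 1 + C $ 2 $ 2" "complex_of_real (det M) = det C"
    by (auto simp: T_def C_def det_2 map_matrix_def)
  obtain l m where lm: "l + m = complex_of_real T" "l * m = complex_of_real (det M)"
    by (rule complex_quadratic_roots)
  have "l\<^sup>2 - complex_of_real T * l + complex_of_real (det M) = 0"
    "m\<^sup>2 - complex_of_real T * m + complex_of_real (det M) = 0"
    unfolding lm[symmetric] by (simp_all add: power2_eq_square algebra_simps)
  then have gt: "cmod l > 1" "cmod m > 1"
    using assms eigenvector_2[of l C] eigenvector_2[of m C] unfolding expanding_def C_def[symmetric] C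
    by blast+
  then have nz: "l \<noteq> 0" "m \<noteq> 0" by auto
  then show det: "det M \<noteq> 0" using lm by auto
  define y where "y n = (((*v) (matrix_inv M)) ^^ n) x" for n
  \<comment> \<open>This is Cayley-Hamilton at \<open>y (Suc (Suc n))\<close>, since
    \<open>M\<close> moves one step back along \<open>y\<close>.\<close>
  have rec: "y n = T *s y (Suc n) - det M *s y (Suc (Suc n))" for n
  proof -
    have "y (Suc n) = M *v y (Suc (Suc n))" "y n = M *v y (Suc n)"
      by (simp_all add: y_def matrix_inv_inverse det)
    then show ?thesis by (metis cayley_hamilton_2 T_def)
  qed
  \<comment> \<open>Each coordinate is viewed as a complex sequence because \<open>l\<close> and
    \<open>m\<close> may be non-real.\<close>
  have "summable (\<lambda>n. cmod (complex_of_real (y n $ i)))" for i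
  proof (rule summable_linear_recurrence[of _ "1 / l" "1 / m"])
    fix n
    have "complex_of_real (y n $ i) = (l + m) * complex_of_real (y (Suc n) $ i)
       - l * m * complex_of_real (y (Suc (Suc n)) $ i)"
      unfolding lm by (subst rec) simp
    then show "complex_of_real (y (Suc (Suc n)) $ i) =
      (1 / l + 1 / m) * complex_of_real (y (Suc n) $ i) - 1 / l * (1 / m) * complex_of_real (y n $ i)"
      using nz by (simp add: divide_simps)
  qed (use gt nz in \<open>auto simp: norm_divide\<close>)
  then have "summable (\<lambda>n. \<Sum>i\<in>UNIV. \<bar>y n $ i\<bar>)" by (intro summable_sum) auto
  then show "summable (\<lambda>n. norm (y n))"
    by (rule summable_comparison_test') (auto intro: norm_le_l1_cart)
qed

text \<open>The discriminant forces every eigenvalue \<open>z\<close> to be non-real. Imaginary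
  parts of the characteristic equation then give the trace as \<open>2 * Re z\<close>, and real
  parts give the squared modulus of \<open>z\<close> as \<open>det M\<close>.\<close>

lemma expanding_of_neg_discriminant:
  fixes M :: "real ^ 2 ^ 2"
  assumes disc: "(M $ 1 $ 1 + M $ 2 $ 2)\<^sup>2 < 4 * det M" and det: "det M > 1"
  shows "expanding M"
  unfolding expanding_def
proof (intro allI impI, elim exE conjE)
  fix z :: complex and v
  define C where "C = map_matrix complex_of_real M"
  define t where "t = M $ 1 $ 1 + M $ 2 $ 2"
  assume "v \<noteq> 0" "map_matrix complex_of_real M *v v = z *s v"
  then have v: "C *v v = z *s v" "v \<noteq> 0" by (auto simp: C_def)
  have C: "C $ 1 $ 1 + C $ 2 $ 2 = complex_of_real t" "det C = complex_of_real (det M)"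
    by (auto simp: t_def C_def det_2 map_matrix_def)
  have "z *s (z *s v) = complex_of_real t *s (z *s v) - complex_of_real (det M) *s v"
    using cayley_hamilton_2[of C v] by (simp add: v(1) C vector_scalar_commute)
  moreover obtain i where "v $ i \<noteq> 0" using v(2) by (auto simp: vec_eq_iff)
  ultimately have z: "z * z = complex_of_real t * z - complex_of_real (det M)"
    by (auto simp: vec_eq_iff left_diff_distrib[symmetric] mult.assoc[symmetric])
  then have re: "Re z * Re z - Im z * Im z = t * Re z - det M" and im: "2 * (Re z * Im z) = t * Im z"
    by (simp_all add: complex_eq_iff)
  have "Im z \<noteq> 0"
  proof
    assume "Im z = 0"
    then have "(2 * Re z - t)\<^sup>2 = t\<^sup>2 - 4 * det M" using re by (simp add: power2_eq_square algebra_simps)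
    moreover have "(2 * Re z - t)\<^sup>2 \<ge> 0" by simp
    ultimately show False using disc by (simp add: t_def)
  qed
  then have "t = 2 * Re z" using im by simp
  then have "Re z * Re z + Im z * Im z = det M" using re by (simp add: algebra_simps)
  then have "(cmod z)\<^sup>2 = det M" by (subst cmod_power2) (simp add: power2_eq_square)
  then show "cmod z > 1" using det by (metis norm_ge_zero one_power2 power_less_imp_less_base)
qed

section \<open>Existence and uniqueness of the self-affine measure\<close>

lemma ifs_map_measurable [measurable]:
  "(\<lambda>x. ifs_map M d x) \<in> borel_measurable borel"
  unfolding ifs_map_def
  by (intro borel_measurable_continuous_onI continuous_on_compose2[OF matrix_vector_mult_linear_continuous_on]
      continuous_intros) auto

lemma ifs_map_pair_measurable [measurable]:
  "(\<lambda>(d, x). ifs_map M d x) \<in> borel_measurable (uniform_count_measure D \<Otimes>\<^sub>M borel)"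
proof -
  have "(\<lambda>d. d) \<in> measurable (uniform_count_measure D) borel"
    by (simp add: measurable_cong_sets[OF sets_uniform_count_measure_count_space refl])
  then have "(\<lambda>z. fst z + snd z) \<in> borel_measurable (uniform_count_measure D \<Otimes>\<^sub>M borel)"
    by measurable
  \<comment> \<open>The map depends only on the sum of digit and point, so the digit can be absorbed
    into the argument.\<close>
  then have "(\<lambda>z. ifs_map M 0 (fst z + snd z)) \<in> borel_measurable (uniform_count_measure D \<Otimes>\<^sub>M borel)"
    by measurable
  then show ?thesis by (simp add: ifs_map_def case_prod_unfold add.commute)
qed

text \<open>Choosing a digit uniformly and applying its map turns the weighted sum into one
  push-forward from a product space. Fubini and the random-series construction then apply to
  invariance.\<close>

lemma is_self_affine_measure_iff_distr:
  assumes D: "finite D" "D \<noteq> {}"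
  shows "is_self_affine_measure M D \<mu> \<longleftrightarrow> prob_space \<mu> \<and> sets \<mu> = sets borel \<and>
    distr (uniform_count_measure D \<Otimes>\<^sub>M \<mu>) borel (\<lambda>(d, x). ifs_map M d x) = \<mu>"
proof -
  have "measure \<mu> A = 1 / real (card D) * (\<Sum>d\<in>D. measure \<mu> (ifs_map M d -` A)) \<longleftrightarrow>
     emeasure (distr (uniform_count_measure D \<Otimes>\<^sub>M \<mu>) borel (\<lambda>(d, x). ifs_map M d x)) A = emeasure \<mu> A"
    if \<mu>: "prob_space \<mu>" "sets \<mu> = sets borel" and A: "A \<in> sets borel" for A
  proof -
    interpret prob_space \<mu> by fact
    have sp: "space \<mu> = UNIV" using sets_eq_imp_space_eq[OF \<mu>(2)] by simp
    have [measurable]: "(\<lambda>(d, x). ifs_map M d x) \<in> borel_measurable (uniform_count_measure D \<Otimes>\<^sub>M \<mu>)"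
      using ifs_map_pair_measurable[of M D]
      by (simp add: measurable_cong_sets[OF sets_pair_measure_cong[OF refl \<mu>(2)] refl])
    have "emeasure (distr (uniform_count_measure D \<Otimes>\<^sub>M \<mu>) borel (\<lambda>(d, x). ifs_map M d x)) A
      = emeasure (uniform_count_measure D \<Otimes>\<^sub>M \<mu>)
          ((\<lambda>(d, x). ifs_map M d x) -` A \<inter> space (uniform_count_measure D \<Otimes>\<^sub>M \<mu>))"
      using A by (simp add: emeasure_distr)
    also have "\<dots> = (\<integral>\<^sup>+d. emeasure \<mu> (Pair d -` ((\<lambda>(d, x). ifs_map M d x) -` A \<inter>
        space (uniform_count_measure D \<Otimes>\<^sub>M \<mu>))) \<partial>uniform_count_measure D)"
      using A by (intro emeasure_pair_measure_alt measurable_sets[where A=borel]) auto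
    also have "\<dots> = (\<integral>\<^sup>+d. emeasure \<mu> (ifs_map M d -` A) \<partial>uniform_count_measure D)"
      by (intro nn_integral_cong arg_cong[where f="emeasure \<mu>"])
        (auto simp: space_pair_measure sp)
    also have "\<dots> = (\<Sum>d\<in>D. ennreal (1 / real (card D)) * ennreal (measure \<mu> (ifs_map M d -` A)))"
      unfolding uniform_count_measure_def
      by (subst nn_integral_point_measure_finite) (auto simp: D emeasure_eq_measure)
    also have "\<dots> = ennreal (1 / real (card D) * (\<Sum>d\<in>D. measure \<mu> (ifs_map M d -` A)))"
      by (simp add: sum_distrib_left ennreal_mult'[symmetric] sum_ennreal del: times_divide_eq_left)
    finally show ?thesis by (simp add: emeasure_eq_measure sum_nonneg) fastforce
  qed
  then show ?thesis
    unfolding is_self_affine_measure_def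
    by (auto intro!: measure_eqI)
qed

text \<open>Change of variables and Fubini carry invariance from sets to bounded functions. Values
  in a Banach space serve both the real test functions and the complex exponentials.\<close>

lemma integral_self_affine:
  fixes f :: "real ^ 2 \<Rightarrow> 'a :: {banach, second_countable_topology}"
  assumes D: "finite D" "D \<noteq> {}" and \<mu>: "is_self_affine_measure M D \<mu>"
    and f: "f \<in> borel_measurable borel" and bd: "\<And>x. norm (f x) \<le> B"
  shows "(\<integral>x. f x \<partial>\<mu>) = (\<Sum>d\<in>D. (1 / real (card D)) *\<^sub>R (\<integral>x. f (ifs_map M d x) \<partial>\<mu>))"
proof -
  let ?U = "uniform_count_measure D"
  have inv: "distr (?U \<Otimes>\<^sub>M \<mu>) borel (\<lambda>(d, x). ifs_map M d x) = \<mu>"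
    and "prob_space \<mu>" and s [measurable_cong]: "sets \<mu> = sets borel"
    using \<mu> is_self_affine_measure_iff_distr[OF D] by auto
  then interpret prob_space \<mu> by simp
  interpret U: prob_space ?U by (rule prob_space_uniform_count_measure[OF D])
  interpret pair_prob_space ?U \<mu> ..
  note [measurable] = f
  have "(\<integral>x. f x \<partial>\<mu>) = (\<integral>x. f x \<partial>distr (?U \<Otimes>\<^sub>M \<mu>) borel (\<lambda>(d, x). ifs_map M d x))"
    by (simp only: inv)
  also have "\<dots> = (\<integral>z. f (case z of (d, x) \<Rightarrow> ifs_map M d x) \<partial>(?U \<Otimes>\<^sub>M \<mu>))"
    by (rule integral_distr) measurable
  also have "\<dots> = (\<integral>d. \<integral>x. f (case (d, x) of (d, x) \<Rightarrow> ifs_map M d x) \<partial>\<mu> \<partial>?U)"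
    by (rule integral_fst'[symmetric], rule P.integrable_const_bound[where B=B])
      (simp_all add: bd)
  finally show ?thesis
    by (simp add: uniform_count_measure_def lebesgue_integral_point_measure_finite D)
qed

section \<open>The transfer operator and uniqueness\<close>

definition transfer_op :: "real ^ 2 ^ 2 \<Rightarrow> (real ^ 2) set \<Rightarrow> (real ^ 2 \<Rightarrow> real) \<Rightarrow> real ^ 2 \<Rightarrow> real" where
  "transfer_op M D f x = (\<Sum>d\<in>D. 1 / real (card D) * f (ifs_map M d x))"

lemma transfer_op_Suc:
  "(transfer_op M D ^^ Suc n) f x = (\<Sum>d\<in>D. 1 / real (card D) * (transfer_op M D ^^ n) f (ifs_map M d x))"
  by (simp add: transfer_op_def)

lemma abs_average_le:
  assumes "finite D" "D \<noteq> {}" "\<And>d. d \<in> D \<Longrightarrow> \<bar>g d\<bar> \<le> (B::real)"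
  shows "\<bar>\<Sum>d\<in>D. 1 / real (card D) * g d\<bar> \<le> B"
proof -
  have "\<bar>\<Sum>d\<in>D. 1 / real (card D) * g d\<bar> \<le> (\<Sum>d\<in>D. 1 / real (card D) * B)"
    using assms by (intro order.trans[OF sum_abs] sum_mono) (auto simp: abs_mult intro: divide_right_mono)
  then show ?thesis using assms by simp
qed

lemma transfer_op_bounded:
  assumes D: "finite D" "D \<noteq> {}" and "\<And>x. \<bar>f x\<bar> \<le> B"
  shows "\<bar>(transfer_op M D ^^ n) f x\<bar> \<le> B"
proof (induction n arbitrary: x)
  case (Suc n)
  show ?case unfolding transfer_op_Suc by (intro abs_average_le[OF D] Suc)
qed (simp add: assms)

lemma transfer_op_measurable:
  assumes "f \<in> borel_measurable borel"
  shows "(transfer_op M D ^^ n) f \<in> borel_measurable borel"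
proof (induction n)
  case (Suc n)
  note [measurable] = Suc
  have "(transfer_op M D ^^ Suc n) f
      = (\<lambda>x. \<Sum>d\<in>D. 1 / real (card D) * (transfer_op M D ^^ n) f (ifs_map M d x))"
    by (rule ext) (rule transfer_op_Suc)
  then show ?case by simp
qed (simp add: assms)

text \<open>The operator is dual to the averaging of measures by the digit maps, so a fixed point of
  that averaging does not see it.\<close>

lemma integral_transfer_op:
  assumes D: "finite D" "D \<noteq> {}" and \<mu>: "is_self_affine_measure M D \<mu>"
    and f: "f \<in> borel_measurable borel" and bd: "\<And>x. \<bar>f x\<bar> \<le> B"
  shows "(\<integral>x. (transfer_op M D ^^ n) f x \<partial>\<mu>) = (\<integral>x. f x \<partial>\<mu>)"
proof (induction n)
  case (Suc n)
  define g where "g = (transfer_op M D ^^ n) f"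
  have g [measurable]: "g \<in> borel_measurable borel" unfolding g_def by (rule transfer_op_measurable[OF f])
  have gb: "norm (g x) \<le> B" for x
    using transfer_op_bounded[OF D, of f B n M x] bd by (simp add: g_def)
  interpret prob_space \<mu> using \<mu> by (simp add: is_self_affine_measure_def)
  have [measurable_cong]: "sets \<mu> = sets borel" using \<mu> by (simp add: is_self_affine_measure_def)
  have "(\<integral>x. (transfer_op M D ^^ Suc n) f x \<partial>\<mu>) = (\<Sum>d\<in>D. (1 / real (card D)) *\<^sub>R (\<integral>x. g (ifs_map M d x) \<partial>\<mu>))"
    unfolding transfer_op_Suc g_def[symmetric]
    by (subst Bochner_Integration.integral_sum)
      (auto intro!: integrable_divide_zero integrable_mult_right integrable_const_bound[where B=B] gb[unfolded real_norm_def])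
  also have "\<dots> = (\<integral>x. g x \<partial>\<mu>)" by (rule integral_self_affine[OF D \<mu> g gb, symmetric])
  finally show ?case using Suc by (simp add: g_def)
qed simp

text \<open>All digit maps have the same linear part, so the difference of two images does not
  depend on the digit. The bound keeps the powers of the inverse matrix, since a single application
  may increase the Euclidean norm.\<close>

lemma transfer_op_contracts:
  assumes D: "finite D" "D \<noteq> {}" and L: "\<And>x y. \<bar>f x - f y\<bar> \<le> L * norm (x - y)"
  shows "\<bar>(transfer_op M D ^^ n) f x - (transfer_op M D ^^ n) f y\<bar>
    \<le> L * norm (((*v) (matrix_inv M) ^^ n) (x - y))"
proof (induction n arbitrary: x y)
  case (Suc n)
  let ?g = "(transfer_op M D ^^ n) f"
  have "\<bar>?g (ifs_map M d x) - ?g (ifs_map M d y)\<bar>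
      \<le> L * norm (((*v) (matrix_inv M) ^^ n) (matrix_inv M *v (x - y)))" for d
    using Suc[of "ifs_map M d x" "ifs_map M d y"]
    by (simp add: ifs_map_def matrix_vector_mult_diff_distrib[symmetric])
  then have "\<bar>\<Sum>d\<in>D. 1 / real (card D) * (?g (ifs_map M d x) - ?g (ifs_map M d y))\<bar>
    \<le> L * norm (((*v) (matrix_inv M) ^^ n) (matrix_inv M *v (x - y)))"
    by (intro abs_average_le[OF D])
  moreover have "(\<Sum>d\<in>D. 1 / real (card D) * (?g (ifs_map M d x) - ?g (ifs_map M d y)))
      = transfer_op M D ?g x - transfer_op M D ?g y"
    by (simp only: transfer_op_def right_diff_distrib sum_subtractf)
  ultimately show ?case by (simp add: funpow_swap1)
qed (simp add: L)

text \<open>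
  The iterates of the transfer operator have the same integral as \<open>f\<close> against every invariant measure and flatten
  \<open>f\<close> to a constant, so any two invariant measures give \<open>f\<close> the same integral.
\<close>

lemma self_affine_integral_unique:
  assumes M: "expanding M" and D: "finite D" "D \<noteq> {}"
    and \<mu>: "is_self_affine_measure M D \<mu>" and \<nu>: "is_self_affine_measure M D \<nu>"
    and f: "f \<in> borel_measurable borel" and bd: "\<And>x. \<bar>f x\<bar> \<le> B"
    and L: "\<And>x y. \<bar>f x - f y\<bar> \<le> L * norm (x - y)"
  shows "(\<integral>x. f x \<partial>\<mu>) = (\<integral>x. f x \<partial>\<nu>)"
proof -
  define g where "g n = (transfer_op M D ^^ n) f" for n
  have lim: "(\<lambda>n. (\<integral>x. f x \<partial>\<mu>) - g n 0) \<longlonglongrightarrow> 0" if \<mu>: "is_self_affine_measure M D \<mu>" for \<mu>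
  proof -
    interpret prob_space \<mu> using \<mu> by (simp add: is_self_affine_measure_def)
    have [measurable_cong]: "sets \<mu> = sets borel" using \<mu> by (simp add: is_self_affine_measure_def)
    have [measurable]: "g n \<in> borel_measurable borel" for n
      unfolding g_def by (rule transfer_op_measurable[OF f])
    have gb: "\<bar>g n x\<bar> \<le> B" for n x unfolding g_def by (rule transfer_op_bounded[OF D bd])
    have int: "integrable \<mu> (g n)" for n by (rule integrable_const_bound[where B=B]) (auto simp: gb)
    have "(\<lambda>n. \<integral>x. (g n x - g n 0) \<partial>\<mu>) \<longlonglongrightarrow> (\<integral>x. 0 \<partial>\<mu>)"
    proof (rule integral_dominated_convergence[where w="\<lambda>_. 2 * B"])
      have "(\<lambda>n. g n x - g n 0) \<longlonglongrightarrow> 0" for x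
      proof (rule tendsto_rabs_zero_cancel, rule tendsto_sandwich[OF _ _ tendsto_const])
        show "eventually (\<lambda>n. \<bar>g n x - g n 0\<bar> \<le> L * norm (((*v) (matrix_inv M) ^^ n) x)) sequentially"
          using transfer_op_contracts[OF D L, of _ M x 0] by (simp add: g_def)
        show "(\<lambda>n. L * norm (((*v) (matrix_inv M) ^^ n) x)) \<longlonglongrightarrow> 0"
          by (rule tendsto_mult_right_zero, rule summable_LIMSEQ_zero,
              rule expanding_det_nz_and_summable[OF M])
      qed simp
      then show "AE x in \<mu>. (\<lambda>n. g n x - g n 0) \<longlonglongrightarrow> 0" by simp
      show "AE x in \<mu>. norm (g n x - g n 0) \<le> 2 * B" for n
      proof (rule AE_I2)
        show "norm (g n x - g n 0) \<le> 2 * B" for x using gb[of n x] gb[of n 0] by simp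
      qed
    qed simp_all
    moreover have "(\<integral>x. (g n x - g n 0) \<partial>\<mu>) = (\<integral>x. f x \<partial>\<mu>) - g n 0" for n
      using integral_transfer_op[OF D \<mu> f bd, of n]
      by (simp add: int prob_space g_def[symmetric])
    ultimately show ?thesis by simp
  qed
  \<comment> \<open>The reference value \<open>g n 0\<close> is the same for both measures and
    cancels.\<close>
  have "(\<lambda>n. ((\<integral>x. f x \<partial>\<mu>) - g n 0) - ((\<integral>x. f x \<partial>\<nu>) - g n 0)) \<longlonglongrightarrow> 0 - 0"
    by (intro tendsto_diff lim \<mu> \<nu>)
  then show ?thesis by (simp add: LIMSEQ_const_iff)
qed

text \<open>The indicator of an open set is the limit of bounded Lipschitz functions, on which the
  two measures agree. Open sets form a generator closed under intersection.\<close>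

lemma self_affine_measure_unique:
  assumes M: "expanding M" and D: "finite D" "D \<noteq> {}"
    and \<mu>: "is_self_affine_measure M D \<mu>" and \<nu>: "is_self_affine_measure M D \<nu>"
  shows "\<mu> = \<nu>"
proof -
  have prob: "prob_space \<mu>" "prob_space \<nu>" and sets: "sets \<mu> = sets borel" "sets \<nu> = sets borel"
    using \<mu> \<nu> by (auto simp: is_self_affine_measure_def)
  interpret \<mu>: prob_space \<mu> by fact
  interpret \<nu>: prob_space \<nu> by fact
  have sp: "space \<mu> = UNIV" "space \<nu> = UNIV" using sets[THEN sets_eq_imp_space_eq] by auto
  have "emeasure \<mu> U = emeasure \<nu> U" if U: "open U" for U
  \<comment> \<open>The whole space is treated apart: \<open>infdist\<close> to the empty set is 0
    by convention, so the functions \<open>f k\<close> below would vanish there.\<close>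
  proof (cases "U = UNIV")
    case True
    then show ?thesis using \<mu>.emeasure_space_1 \<nu>.emeasure_space_1 sp by simp
  next
    case False
    define f where "f k x = min 1 (real k * infdist x (- U))" for k and x :: "real ^ 2"
    have cont: "continuous_on UNIV (f k)" for k
      unfolding f_def by (intro continuous_intros)
    have meas [measurable]: "f k \<in> borel_measurable borel" for k
      using cont by (rule borel_measurable_continuous_onI)
    have bd: "\<bar>f k x\<bar> \<le> 1" for k x by (simp add: f_def infdist_nonneg)
    have L: "\<bar>f k x - f k y\<bar> \<le> real k * norm (x - y)" for k x y
    proof -
      have "\<bar>f k x - f k y\<bar> \<le> \<bar>real k * infdist x (- U) - real k * infdist y (- U)\<bar>"
        by (auto simp: f_def min_def)
      also have "\<dots> = real k * \<bar>infdist x (- U) - infdist y (- U)\<bar>"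
        by (simp add: abs_mult right_diff_distrib[symmetric])
      also have "\<dots> \<le> real k * norm (x - y)"
        using infdist_triangle_abs[of x "- U" y] by (simp add: mult_left_mono dist_norm)
      finally show ?thesis .
    qed
    have lim: "(\<lambda>k. f k x) \<longlonglongrightarrow> indicator U x" for x
    proof (cases "x \<in> U")
      case True
      then have "infdist x (- U) > 0"
        using U False infdist_pos_not_in_closed[of "- U" x] by auto
      then obtain N where N: "1 < real N * infdist x (- U)" using ex_less_of_nat_mult by blast
      have "f k x = 1" if "k \<ge> N" for k
      proof -
        have "real N * infdist x (- U) \<le> real k * infdist x (- U)"
          using that by (intro mult_right_mono) (auto simp: infdist_nonneg)
        then show ?thesis using N by (simp add: f_def)
      qed
      then have "eventually (\<lambda>k. f k x = 1) sequentially" using eventually_sequentially by blast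
      then show ?thesis using True by (simp add: tendsto_eventually)
    next
      case False
      then show ?thesis by (simp add: f_def)
    qed
    have conv: "(\<lambda>k. \<integral>x. f k x \<partial>\<mu>) \<longlonglongrightarrow> measure \<mu> U"
      if "prob_space \<mu>" and [measurable_cong]: "sets \<mu> = sets borel" for \<mu>
    proof -
      interpret prob_space \<mu> by fact
      have "(\<lambda>k. \<integral>x. f k x \<partial>\<mu>) \<longlonglongrightarrow> (\<integral>x. indicator U x \<partial>\<mu>)"
        by (rule integral_dominated_convergence[where w="\<lambda>_. 1"]) (use bd lim borel_open[OF U] in auto)
      moreover have "space \<mu> = UNIV" using that(2)[THEN sets_eq_imp_space_eq] by simp
      ultimately show ?thesis by simp
    qed
    have "(\<integral>x. f k x \<partial>\<mu>) = (\<integral>x. f k x \<partial>\<nu>)" for k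
      by (rule self_affine_integral_unique[OF M D \<mu> \<nu> meas bd L])
    then have "measure \<mu> U = measure \<nu> U"
      using conv[OF prob(1) sets(1)] conv[OF prob(2) sets(2)] LIMSEQ_unique by auto
    then show ?thesis by (simp add: \<mu>.emeasure_eq_measure \<nu>.emeasure_eq_measure)
  qed
  then show ?thesis
    by (intro measure_eqI_generator_eq[where E="{S. open S}" and \<Omega>=UNIV and A="\<lambda>_. UNIV"])
      (auto simp: Int_stable_def sets sets_borel)
qed

section \<open>Existence by a random digit series\<close>

text \<open>
  The invariant measure is the law of the random series \<open>\<Sum>k. A ^ (k + 1) (\<omega> k)\<close>, with \<open>A\<close> the inverse of \<open>M\<close>
  and independent uniform digits \<open>\<omega> k\<close>; prepending a digit to \<open>\<omega>\<close> applies the corresponding map.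
\<close>

lemma self_affine_measure_exists:
  assumes M: "expanding M" and D: "finite D" "D \<noteq> {}"
  shows "\<exists>\<mu>. is_self_affine_measure M D \<mu>"
proof -
  define A where "A = matrix_inv M"
  define U where "U = uniform_count_measure D"
  interpret U: prob_space U unfolding U_def by (rule prob_space_uniform_count_measure[OF D])
  interpret sequence_space U ..
  define s where "s \<omega> k = ((*v) A ^^ Suc k) (\<omega> k)" for \<omega> :: "nat \<Rightarrow> real ^ 2" and k
  define X where "X \<omega> = (\<Sum>k. s \<omega> k)" for \<omega>
  have spU: "space U = D" by (simp add: U_def space_uniform_count_measure)
  have spS: "\<omega> \<in> space S \<longleftrightarrow> (\<forall>k. \<omega> k \<in> D)" for \<omega>
    by (auto simp: space_PiM spU PiE_iff)
  have summ: "summable (s \<omega>)" if "\<omega> \<in> space S" for \<omega>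
  proof (rule summable_comparison_test')
    \<comment> \<open>Summing over the finitely many digits gives a majorant independent of the
      digit sequence.\<close>
    show "summable (\<lambda>k. \<Sum>d\<in>D. norm (((*v) A ^^ Suc k) d))"
      unfolding A_def by (intro summable_sum summable_ignore_initial_segment[where k=1, simplified]
         expanding_det_nz_and_summable[OF M])
    show "norm (s \<omega> k) \<le> (\<Sum>d\<in>D. norm (((*v) A ^^ Suc k) d))" for k
      unfolding s_def using that D(1) spS
      by (intro member_le_sum[where f="\<lambda>d. norm (((*v) A ^^ Suc k) d)"]) auto
  qed
  have s_meas [measurable]: "(\<lambda>\<omega>. s \<omega> k) \<in> borel_measurable S" for k
  proof -
    have "((*v) A ^^ Suc k) \<in> borel_measurable U"
      by (simp add: U_def measurable_cong_sets[OF sets_uniform_count_measure_count_space refl])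
    then show ?thesis unfolding s_def by (rule measurable_compose[rotated]) simp
  qed
  have X_meas [measurable]: "X \<in> borel_measurable S"
  proof (rule borel_measurable_LIMSEQ_metric)
    show "(\<lambda>n. \<Sum>k<n. s \<omega> k) \<longlonglongrightarrow> X \<omega>" if "\<omega> \<in> space S" for \<omega>
      unfolding X_def by (rule summable_LIMSEQ[OF summ[OF that]])
  qed measurable
  have X_shift: "X (case_nat d \<omega>) = ifs_map M d (X \<omega>)" if "d \<in> D" "\<omega> \<in> space S" for d \<omega>
  proof -
    have "case_nat d \<omega> \<in> space S" using that by (auto simp: spS split: nat.split)
    then have "X (case_nat d \<omega>) = A *v d + (\<Sum>k. s (case_nat d \<omega>) (Suc k))"
      unfolding X_def by (subst suminf_split_head[OF summ]) (auto simp: s_def)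
    also have "(\<lambda>k. s (case_nat d \<omega>) (Suc k)) = (\<lambda>k. A *v s \<omega> k)"
      by (simp add: s_def fun_eq_iff)
    also have "(\<Sum>k. A *v s \<omega> k) = A *v X \<omega>"
      unfolding X_def
      by (rule bounded_linear.suminf[OF _ summ[OF that(2)], symmetric])
        (simp add: linear_linear matrix_vector_mul_linear)
    finally show ?thesis by (simp add: ifs_map_def A_def matrix_vector_right_distrib)
  qed
  define \<mu> where "\<mu> = distr S borel X"
  have "prob_space \<mu>" unfolding \<mu>_def by (rule P.prob_space_distr) measurable
  interpret \<mu>: prob_space \<mu> by fact
  have [measurable]: "(\<lambda>(d, x). ifs_map M d x) \<in> borel_measurable (U \<Otimes>\<^sub>M borel)"
    unfolding U_def by measurable
  have "U \<Otimes>\<^sub>M \<mu> = distr U U (\<lambda>x. x) \<Otimes>\<^sub>M \<mu>" by (simp add: distr_id2)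
  also have "\<dots> = distr (U \<Otimes>\<^sub>M S) (U \<Otimes>\<^sub>M borel) (\<lambda>(d, \<omega>). (d, X \<omega>))"
    unfolding \<mu>_def
    by (rule pair_measure_distr) (auto intro: \<mu>.sigma_finite_measure_axioms[unfolded \<mu>_def])
  finally have "distr (U \<Otimes>\<^sub>M \<mu>) borel (\<lambda>(d, x). ifs_map M d x)
    = distr (distr (U \<Otimes>\<^sub>M S) (U \<Otimes>\<^sub>M borel) (\<lambda>(d, \<omega>). (d, X \<omega>))) borel (\<lambda>(d, x). ifs_map M d x)"
    by simp
  also have "\<dots> = distr (U \<Otimes>\<^sub>M S) borel ((\<lambda>(d, x). ifs_map M d x) \<circ> (\<lambda>(d, \<omega>). (d, X \<omega>)))"
    by (rule distr_distr) measurable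
  also have "\<dots> = distr (U \<Otimes>\<^sub>M S) borel (X \<circ> (\<lambda>(d, \<omega>). case_nat d \<omega>))"
    by (rule distr_cong) (auto simp: space_pair_measure X_shift spU)
  also have "\<dots> = distr (distr (U \<Otimes>\<^sub>M S) S (\<lambda>(d, \<omega>). case_nat d \<omega>)) borel X"
    by (rule distr_distr[symmetric]) measurable
  \<comment> \<open>Prepending an independent digit to a sequence of independent digits leaves the
    product measure unchanged.\<close>
  also have "\<dots> = \<mu>" by (simp add: PiM_iter \<mu>_def)
  finally have "is_self_affine_measure M D \<mu>"
    unfolding is_self_affine_measure_iff_distr[OF D] U_def using \<open>prob_space \<mu>\<close>
    by (simp add: \<mu>_def)
  then show ?thesis by blast
qed

text \<open>This makes the \<open>THE\<close> in the definition meaningful; afterwards the measure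
  is used only through its invariance.\<close>

lemma self_affine_measure:
  assumes "expanding M" "finite D" "D \<noteq> {}"
  shows "is_self_affine_measure M D (self_affine_measure M D)"
  unfolding self_affine_measure_def
  by (rule theI') (use self_affine_measure_exists[OF assms] self_affine_measure_unique[OF assms] in blast)

section \<open>The Fourier transform of the self-affine measure\<close>

definition fourier :: "(real ^ 2) measure \<Rightarrow> real ^ 2 \<Rightarrow> complex" where
  "fourier \<mu> \<xi> = (\<integral>x. exp_fun \<xi> x \<partial>\<mu>)"

lemma exp_fun_conv_exp: "exp_fun \<xi> x = exp (\<i> * complex_of_real (2 * pi * (\<xi> \<bullet> x)))"
  by (simp add: exp_fun_def mult_ac)

lemma norm_exp_fun: "cmod (exp_fun \<xi> x) = 1"
  by (simp add: exp_fun_conv_exp del: of_real_mult)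

lemma exp_fun_commute: "exp_fun \<xi> x = exp_fun x \<xi>"
  by (simp add: exp_fun_def inner_commute)

lemma exp_fun_add_right: "exp_fun \<xi> (x + y) = exp_fun \<xi> x * exp_fun \<xi> y"
  by (simp add: exp_fun_def inner_add_right exp_add[symmetric] algebra_simps)

lemma exp_fun_cnj: "exp_fun a x * cnj (exp_fun b x) = exp_fun (a - b) x"
  by (simp add: exp_fun_def exp_cnj exp_add[symmetric] inner_diff_left algebra_simps)

lemma exp_fun_continuous: "continuous_on UNIV (exp_fun \<xi>)"
  unfolding exp_fun_def by (intro continuous_intros)

lemma exp_fun_measurable [measurable]: "exp_fun \<xi> \<in> borel_measurable borel"
  by (rule borel_measurable_continuous_onI[OF exp_fun_continuous])

text \<open>Orthogonality thus becomes the vanishing of the Fourier transform at frequency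
  differences.\<close>

lemma L2_inner_exp_fun: "L2_inner \<mu> (exp_fun a) (exp_fun b) = fourier \<mu> (a - b)"
  by (simp add: L2_inner_def fourier_def exp_fun_cnj)

section \<open>Integer vectors and periodicity of the mask\<close>

lemma real_vec_inner: "real_vec d \<bullet> real_vec k = real_of_int (\<Sum>i\<in>UNIV. d $ i * k $ i)"
  by (simp add: inner_vec_def real_vec_def)

lemma real_vec_add: "real_vec (a + b) = real_vec a + real_vec b"
  by (simp add: real_vec_def vec_eq_iff)

lemma real_vec_diff: "real_vec (a - b) = real_vec a - real_vec b"
  by (simp add: real_vec_def vec_eq_iff)

lemma real_vec_smult: "real_vec (c *s a) = real_of_int c *\<^sub>R real_vec a"
  by (simp add: real_vec_def vec_eq_iff)

lemma real_vec_inj: "inj real_vec"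
  by (simp add: inj_def real_vec_def vec_eq_iff)

lemma real_vec_mult: "real_vec (N *v l) = real_mat N *v real_vec l"
  by (simp add: real_vec_def vec_eq_iff matrix_vector_mult_def map_matrix_def)

lemma mask_periodic: "mask D (x + real_vec k) = mask D x"
proof -
  have "exp_fun (real_vec d) (real_vec k) = 1" for d
    using exp_integer_2pi[of "real_of_int (\<Sum>i\<in>UNIV. d $ i * k $ i)"]
    by (simp only: exp_fun_conv_exp real_vec_inner Ints_of_int mult_ac)
  then show ?thesis by (simp add: mask_def exp_fun_add_right)
qed

section \<open>The functional equation and the zeros of the transform\<close>

locale integer_self_affine =
  fixes M :: "int ^ 2 ^ 2" and D :: "(int ^ 2) set"
  assumes expanding: "expanding (real_mat M)" and D: "finite D" "D \<noteq> {}"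
begin

definition "\<mu> = self_affine_measure (real_mat M) (real_vec ` D)"

definition "B = transpose (matrix_inv (real_mat M))"

lemma invariant: "is_self_affine_measure (real_mat M) (real_vec ` D) \<mu>"
  unfolding \<mu>_def by (rule self_affine_measure[OF expanding]) (use D in auto)

sublocale prob_space \<mu>
  using invariant by (simp add: is_self_affine_measure_def)

lemma sets_\<mu> [measurable_cong]: "sets \<mu> = sets borel"
  using invariant by (simp add: is_self_affine_measure_def)

lemma inner_B: "(B *v \<xi>) \<bullet> x = \<xi> \<bullet> (matrix_inv (real_mat M) *v x)"
  unfolding B_def by (simp add: dot_lmul_matrix)

lemma inner_B_pow: "(((*v) B ^^ n) \<xi>) \<bullet> x = \<xi> \<bullet> (((*v) (matrix_inv (real_mat M)) ^^ n) x)"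
  by (induction n arbitrary: x) (simp_all add: inner_B, simp add: funpow_swap1)

lemma transpose_B: "transpose (real_mat M) *v (B *v \<xi>) = \<xi>" "B *v (transpose (real_mat M) *v \<xi>) = \<xi>"
proof -
  note inv = matrix_inv_inverse[OF expanding_det_nz_and_summable(1)[OF expanding]]
  have "(transpose (real_mat M) *v (B *v \<xi>)) \<bullet> x = \<xi> \<bullet> x" for x
    by (simp add: dot_lmul_matrix inner_B inv)
  then show "transpose (real_mat M) *v (B *v \<xi>) = \<xi>" by (metis vector_eq_rdot)
  have "(B *v (transpose (real_mat M) *v \<xi>)) \<bullet> x = \<xi> \<bullet> x" for x
    by (simp add: dot_lmul_matrix inner_B inv)
  then show "B *v (transpose (real_mat M) *v \<xi>) = \<xi>" by (metis vector_eq_rdot)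
qed

text \<open>Invariance is applied to an exponential. Moving the matrix across the inner product
  replaces \<open>\<xi>\<close> by \<open>B *v \<xi>\<close>, and the digit splits off as a factor
  whose average is the mask.\<close>

lemma fourier_step: "fourier \<mu> \<xi> = mask D (B *v \<xi>) * fourier \<mu> (B *v \<xi>)"
proof -
  have card: "card (real_vec ` D) = card D"
    by (rule card_image) (rule inj_on_subset[OF real_vec_inj], simp)
  have "fourier \<mu> \<xi> = (\<Sum>d\<in>real_vec ` D. (1 / real (card (real_vec ` D))) *\<^sub>R
      (\<integral>x. exp_fun \<xi> (ifs_map (real_mat M) d x) \<partial>\<mu>))"
    unfolding fourier_def
    by (rule integral_self_affine[where B=1, OF _ _ invariant]) (use D in \<open>auto simp: norm_exp_fun\<close>)
  also have "\<dots> = (\<Sum>d\<in>D. (1 / real (card D)) *\<^sub>R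
      (\<integral>x. exp_fun \<xi> (ifs_map (real_mat M) (real_vec d) x) \<partial>\<mu>))"
    unfolding card by (rule sum.reindex_cong[OF inj_on_subset[OF real_vec_inj]]) auto
  also have "(\<lambda>d x. exp_fun \<xi> (ifs_map (real_mat M) (real_vec d) x))
      = (\<lambda>d x. exp_fun (real_vec d) (B *v \<xi>) * exp_fun (B *v \<xi>) x)"
  proof (intro ext)
    fix d x
    have "exp_fun \<xi> (ifs_map (real_mat M) (real_vec d) x) = exp_fun (B *v \<xi>) (real_vec d + x)"
      unfolding exp_fun_def inner_B ifs_map_def by (simp add: add.commute)
    then show "exp_fun \<xi> (ifs_map (real_mat M) (real_vec d) x)
        = exp_fun (real_vec d) (B *v \<xi>) * exp_fun (B *v \<xi>) x"
      by (simp add: exp_fun_add_right exp_fun_commute[of "B *v \<xi>" "real_vec d"])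
  qed
  finally show ?thesis
    by (simp add: fourier_def mask_def sum_distrib_left sum_distrib_right scaleR_conv_of_real)
qed

lemma fourier_iterate:
  "fourier \<mu> \<xi> = (\<Prod>k<n. mask D (((*v) B ^^ Suc k) \<xi>)) * fourier \<mu> (((*v) B ^^ n) \<xi>)"
proof (induction n)
  case (Suc n)
  then show ?case using fourier_step[of "((*v) B ^^ n) \<xi>"] by simp
qed simp

text \<open>Moving the powers of \<open>B\<close> to the space variable gives pointwise convergence
  of the exponentials to 1; they are bounded by 1, so dominated convergence applies.\<close>

lemma fourier_tendsto_1: "(\<lambda>n. fourier \<mu> (((*v) B ^^ n) \<xi>)) \<longlonglongrightarrow> 1"
proof -
  have "(\<lambda>n. \<integral>x. exp_fun (((*v) B ^^ n) \<xi>) x \<partial>\<mu>) \<longlonglongrightarrow> (\<integral>x. 1 \<partial>\<mu>)"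
  proof (rule integral_dominated_convergence[where w="\<lambda>_. 1"])
    have "(\<lambda>n. exp_fun (((*v) B ^^ n) \<xi>) x) \<longlonglongrightarrow> 1" for x
    proof -
      have "(\<lambda>n. ((*v) (matrix_inv (real_mat M)) ^^ n) x) \<longlonglongrightarrow> 0"
        by (rule tendsto_norm_zero_cancel)
          (rule summable_LIMSEQ_zero[OF expanding_det_nz_and_summable(2)[OF expanding]])
      then have "(\<lambda>n. exp (2 * complex_of_real pi * \<i> *
          complex_of_real (\<xi> \<bullet> (((*v) (matrix_inv (real_mat M)) ^^ n) x))))
        \<longlonglongrightarrow> exp (2 * complex_of_real pi * \<i> * complex_of_real (\<xi> \<bullet> 0))"
        by (intro tendsto_intros)
      then show ?thesis unfolding exp_fun_def inner_B_pow by simp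
    qed
    then show "AE x in \<mu>. (\<lambda>n. exp_fun (((*v) B ^^ n) \<xi>) x) \<longlonglongrightarrow> 1" by simp
  qed (auto simp: norm_exp_fun)
  then show ?thesis by (simp add: fourier_def prob_space)
qed

text \<open>The transform is nonzero far along the orbit, so a finite product of mask values already
  decides its vanishing. The index is \<open>Suc n\<close> because the mask at \<open>\<xi>\<close>
  itself is not a factor.\<close>

lemma fourier_eq_0_iff: "fourier \<mu> \<xi> = 0 \<longleftrightarrow> (\<exists>n. mask D (((*v) B ^^ Suc n) \<xi>) = 0)"
proof
  assume 0: "fourier \<mu> \<xi> = 0"
  have "eventually (\<lambda>n. fourier \<mu> (((*v) B ^^ n) \<xi>) \<noteq> 0) sequentially"
    by (rule tendsto_imp_eventually_ne[OF fourier_tendsto_1]) simp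
  then obtain n where "fourier \<mu> (((*v) B ^^ n) \<xi>) \<noteq> 0"
    using eventually_happens'[OF sequentially_bot] by blast
  then have "(\<Prod>k<n. mask D (((*v) B ^^ Suc k) \<xi>)) = 0" using 0 fourier_iterate[of \<xi> n] by simp
  then show "\<exists>n. mask D (((*v) B ^^ Suc n) \<xi>) = 0" by (auto simp del: funpow.simps)
next
  assume "\<exists>n. mask D (((*v) B ^^ Suc n) \<xi>) = 0"
  then obtain n where "mask D (((*v) B ^^ Suc n) \<xi>) = 0" ..
  then show "fourier \<mu> \<xi> = 0" using fourier_iterate[of \<xi> "Suc n"] by simp
qed

lemma B_pow_integer:
  "((*v) B ^^ n) (c *\<^sub>R real_vec (((*v) (transpose M) ^^ n) l)) = c *\<^sub>R real_vec l"
proof (induction n arbitrary: l)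
  case (Suc n)
  have "real_vec (transpose M *v l) = transpose (real_mat M) *v real_vec l" for l
    unfolding real_vec_mult by (rule arg_cong[where f="\<lambda>A. A *v real_vec l"])
       (simp add: transpose_def map_matrix_def vec_eq_iff)
  then show ?case using Suc[of "transpose M *v l"]
    by (simp add: funpow_swap1 transpose_B(2) matrix_vector_mult_scaleR del: transpose_matrix_vector)
qed simp

lemma B_pow_inj: "((*v) B ^^ n) \<xi> = ((*v) B ^^ n) \<eta> \<Longrightarrow> \<xi> = \<eta>"
proof (induction n arbitrary: \<xi> \<eta>)
  case (Suc n)
  then have "B *v (((*v) B ^^ n) \<xi>) = B *v (((*v) B ^^ n) \<eta>)" by simp
  then have "((*v) B ^^ n) \<xi> = ((*v) B ^^ n) \<eta>" by (metis transpose_B(1))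
  then show ?case by (rule Suc.IH)
qed simp

end

section \<open>The upper bound\<close>

definition zero_mod :: "nat \<Rightarrow> int ^ 2 \<Rightarrow> bool" where
  "zero_mod p l \<longleftrightarrow> (\<forall>i. int p dvd l $ i)"

text \<open>The adjugate of \<open>N\<close> expresses \<open>det N\<close> times each entry of
  \<open>l\<close> through the entries of \<open>N *v l\<close>, and \<open>det N\<close> is a unit
  modulo \<open>p\<close>.\<close>

lemma zero_mod_matrix_cancel:
  assumes "coprime (det N) (int p)" "zero_mod p (N *v l)"
  shows "zero_mod p l"
proof -
  have "int p dvd det N * l $ 1" "int p dvd det N * l $ 2"
  proof -
    have e: "(N *v l) $ 1 = N$1$1 * l$1 + N$1$2 * l$2" "(N *v l) $ 2 = N$2$1 * l$1 + N$2$2 * l$2"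
      by (simp_all add: matrix_vector_mult_def sum_2)
    have "det N * l $ 1 = N$2$2 * (N *v l) $ 1 - N$1$2 * (N *v l) $ 2"
      "det N * l $ 2 = N$1$1 * (N *v l) $ 2 - N$2$1 * (N *v l) $ 1"
      unfolding e by (simp_all add: det_2 algebra_simps)
    then show "int p dvd det N * l $ 1" "int p dvd det N * l $ 2"
      using assms(2) unfolding zero_mod_def by (auto intro!: dvd_diff)
  qed
  then show ?thesis
    using assms(1) by (simp add: zero_mod_def forall_2 coprime_commute coprime_dvd_mult_right_iff)
qed

lemma zero_mod_matrix_pow_cancel:
  assumes "coprime (det N) (int p)"
  shows "zero_mod p (((*v) N ^^ n) l) \<Longrightarrow> zero_mod p l"
  by (induction n) (auto dest: zero_mod_matrix_cancel[OF assms])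

text \<open>Periodicity moves the zero into the unit square, where the hypothesis on
  \<open>Z_set D\<close> locates it. Undoing the shift changes the numerator by a multiple of
  \<open>p\<close>.\<close>

lemma mask_zero_in_lattice:
  assumes p: "p > 0" and Z: "Z_set D \<subseteq> E_ring p" and y: "mask D y = 0"
  shows "\<exists>l. y = (1 / real p) *\<^sub>R real_vec l \<and> \<not> zero_mod p l"
proof -
  define k :: "int ^ 2" where "k = (\<chi> i. \<lfloor>y $ i\<rfloor>)"
  define f where "f = y - real_vec k"
  have "mask D f = 0" using y mask_periodic[of D f k] by (simp add: f_def)
  moreover have "0 \<le> f $ i \<and> f $ i < 1" for i
    by (simp add: f_def k_def real_vec_def) linarith
  ultimately have "f \<in> E_ring p" using Z by (auto simp: Z_set_def)
  then obtain l where l: "f = (1 / real p) *\<^sub>R real_vec l" "f \<noteq> 0" "\<And>i. 0 \<le> l $ i" "\<And>i. l $ i \<le> int p - 1"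
    by (auto simp: E_ring_def E_set_def)
  have "\<not> zero_mod p l"
  proof
    assume "zero_mod p l"
    then have "l $ i = 0" for i
      using l(3)[of i] l(4)[of i] zdvd_not_zless[of "l $ i" "int p"] unfolding zero_mod_def by force
    then have "l = 0" by (simp add: vec_eq_iff)
    then show False using l by (simp add: real_vec_def vec_eq_iff)
  qed
  moreover have "zero_mod p (l + int p *s k) \<longleftrightarrow> zero_mod p l"
    by (simp add: zero_mod_def dvd_add_left_iff)
  moreover have "y = (1 / real p) *\<^sub>R real_vec (l + int p *s k)"
    using p l(1) unfolding f_def by (simp add: real_vec_add real_vec_smult scaleR_add_right algebra_simps)
  ultimately show ?thesis by blast
qed

text \<open>The transpose of \<open>M\<close> carries the mask zero back along the orbit to
  \<open>\<xi>\<close>; its determinant is prime to \<open>p\<close>, so the numerator stays nonzero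
  modulo \<open>p\<close>.\<close>

lemma (in integer_self_affine) fourier_zero_in_lattice:
  assumes p: "p > 0" and Z: "Z_set D \<subseteq> E_ring p" and cop: "coprime (det M) (int p)"
    and 0: "fourier \<mu> \<xi> = 0"
  shows "\<exists>l. \<xi> = (1 / real p) *\<^sub>R real_vec l \<and> \<not> zero_mod p l"
proof -
  obtain n where "mask D (((*v) B ^^ Suc n) \<xi>) = 0" using 0 fourier_eq_0_iff by blast
  then obtain l where l: "((*v) B ^^ Suc n) \<xi> = (1 / real p) *\<^sub>R real_vec l" "\<not> zero_mod p l"
    using mask_zero_in_lattice[OF p Z] by blast
  define l' where "l' = ((*v) (transpose M) ^^ Suc n) l"
  have "\<xi> = (1 / real p) *\<^sub>R real_vec l'"
    by (rule B_pow_inj[of "Suc n"]) (simp only: l(1) l'_def B_pow_integer)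
  moreover have "\<not> zero_mod p l'"
    using l(2) zero_mod_matrix_pow_cancel[of "transpose M" p "Suc n" l] cop
    by (auto simp: l'_def det_transpose simp del: funpow.simps transpose_matrix_vector)
  ultimately show ?thesis by blast
qed

text \<open>Relative to a base point \<open>c\<close>, distinct elements have numerators in distinct
  residue classes. Finiteness is stated separately because \<open>card\<close> is 0 on infinite
  sets.\<close>

lemma card_le_of_lattice_differences:
  fixes \<Lambda> :: "(real ^ 2) set"
  assumes p: "p > 0"
    and diff: "\<And>a b. a \<in> \<Lambda> \<Longrightarrow> b \<in> \<Lambda> \<Longrightarrow> a \<noteq> b \<Longrightarrow>
      \<exists>l. a - b = (1 / real p) *\<^sub>R real_vec l \<and> \<not> zero_mod p l"
  shows "finite \<Lambda> \<and> card \<Lambda> \<le> p\<^sup>2"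
proof (cases "\<Lambda> = {}")
  case False
  then obtain c where c: "c \<in> \<Lambda>" by blast
  have "\<exists>l. a - c = (1 / real p) *\<^sub>R real_vec l" if "a \<in> \<Lambda>" for a
  proof (cases "a = c")
    case True
    then have "a - c = (1 / real p) *\<^sub>R real_vec 0" by (simp add: real_vec_def vec_eq_iff)
    then show ?thesis ..
  qed (use diff[OF that c] in blast)
  then obtain L where L: "\<And>a. a \<in> \<Lambda> \<Longrightarrow> a - c = (1 / real p) *\<^sub>R real_vec (L a)" by metis
  define r where "r a = (L a $ 1 mod int p, L a $ 2 mod int p)" for a
  have inj: "inj_on r \<Lambda>"
  proof (rule inj_onI, rule ccontr)
    fix a b assume ab: "a \<in> \<Lambda>" "b \<in> \<Lambda>" "r a = r b" "a \<noteq> b"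
    obtain l where l: "a - b = (1 / real p) *\<^sub>R real_vec l" "\<not> zero_mod p l" using diff ab by blast
    have "a - b = (a - c) - (b - c)" by simp
    also have "\<dots> = (1 / real p) *\<^sub>R real_vec (L a - L b)"
      by (simp only: L ab(1,2) real_vec_diff scaleR_diff_right)
    finally have "a - b = (1 / real p) *\<^sub>R real_vec (L a - L b)" .
    then have "real_vec l = real_vec (L a - L b)" using l(1) p by simp
    then have "l = L a - L b" using real_vec_inj by (simp add: inj_eq)
    then have "zero_mod p l" using ab(3) by (simp add: zero_mod_def forall_2 r_def mod_eq_dvd_iff)
    with l(2) show False ..
  qed
  have sub: "r ` \<Lambda> \<subseteq> {0..<int p} \<times> {0..<int p}" using p by (auto simp: r_def)
  have "finite \<Lambda>" using finite_subset[OF sub] inj by (simp add: finite_image_iff)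
  moreover have "card \<Lambda> \<le> card ({0..<int p} \<times> {0..<int p})"
    using card_inj_on_le[OF inj sub] by simp
  ultimately show ?thesis by (simp add: card_cartesian_product power2_eq_square)
qed simp

section \<open>Singer cycles\<close>

text \<open>For \<open>p = 2\<close>, the polynomial with \<open>u = v = 1\<close> takes only odd
  values. For odd \<open>p\<close>, squaring identifies 1 and \<open>p - 1\<close>, so by counting
  it misses some residue \<open>n\<close>, and \<open>u = 0\<close>, \<open>v = - n\<close>
  works.\<close>

lemma ex_irreducible_quadratic_mod:
  fixes p :: int
  assumes p: "prime p"
  shows "\<exists>u v. \<forall>x. \<not> p dvd x\<^sup>2 + u * x + v"
proof (cases "p = 2")
  case True
  have "\<not> 2 dvd x\<^sup>2 + 1 * x + (1 :: int)" for x by simp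
  then show ?thesis unfolding True by blast
next
  case False
  then have p2: "p > 2" using p prime_ge_2_int[of p] by simp
  define sq where "sq x = x\<^sup>2 mod p" for x :: int
  have "\<not> inj_on sq {0..<p}"
  proof
    assume "inj_on sq {0..<p}"
    moreover have "sq 1 = sq (p - 1)" by (simp add: sq_def power2_eq_square mod_eq_dvd_iff algebra_simps)
    ultimately have "1 = p - 1" using p2 by (auto dest!: inj_onD)
    then show False using p2 by simp
  qed
  moreover have sub: "sq ` {0..<p} \<subseteq> {0..<p}" using p2 by (auto simp: sq_def)
  ultimately have "sq ` {0..<p} \<noteq> {0..<p}" by (metis eq_card_imp_inj_on finite_atLeastLessThan_int)
  then obtain n where n: "n \<in> {0..<p}" "n \<notin> sq ` {0..<p}" using sub by blast
  have "\<not> p dvd x\<^sup>2 + 0 * x + (- n)" for x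
  proof
    assume "p dvd x\<^sup>2 + 0 * x + (- n)"
    then have "x\<^sup>2 mod p = n mod p" by (simp add: mod_eq_dvd_iff)
    then have "sq (x mod p) = n" using n(1) by (simp add: sq_def power_mod)
    then show False using n(2) p2 by (metis atLeastLessThan_iff imageI pos_mod_bound pos_mod_sign order.strict_trans zero_less_numeral)
  qed
  then show ?thesis by blast
qed

text \<open>
  A pair \<open>(a, b)\<close> stands for \<open>a + b X\<close> in the integers modulo \<open>p\<close> with a root \<open>X\<close> of \<open>X\<^sup>2 + u X + v\<close> adjoined.
\<close>

locale quadratic_extension =
  fixes p u v :: int
  assumes p: "prime p" and irred: "\<And>x. \<not> p dvd x\<^sup>2 + u * x + v"
begin

text \<open>The field norm of \<open>a + b X\<close>, that is, its product with its
  conjugate.\<close>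

definition qnorm :: "int \<times> int \<Rightarrow> int" where
  "qnorm a = (fst a)\<^sup>2 - u * fst a * snd a + v * (snd a)\<^sup>2"

definition qred :: "int \<times> int \<Rightarrow> int \<times> int" where
  "qred a = (fst a mod p, snd a mod p)"

text \<open>The product is left unreduced so that multiplication by a fixed element is exactly an
  integer matrix.\<close>

definition qmul :: "int \<times> int \<Rightarrow> int \<times> int \<Rightarrow> int \<times> int" where
  "qmul a b = (fst a * fst b - v * snd a * snd b, fst a * snd b + snd a * fst b - u * snd a * snd b)"

definition qadd :: "int \<times> int \<Rightarrow> int \<times> int \<Rightarrow> int \<times> int" where
  "qadd a b = (fst a + fst b, snd a + snd b)"

definition Q :: "(int \<times> int) ring" where
  "Q = \<lparr>carrier = {0..<p} \<times> {0..<p}, monoid.mult = (\<lambda>a b. qred (qmul a b)), one = (1, 0),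
     ring.zero = (0, 0), add = (\<lambda>a b. qred (qadd a b))\<rparr>"

lemma p_gt_1: "p > 1" using p prime_gt_1_int by blast

text \<open>If \<open>y\<close> had an inverse \<open>z\<close> modulo \<open>p\<close>, dividing
  the norm form by the square of \<open>y\<close> would make \<open>- (x * z)\<close> a root of the
  irreducible polynomial.\<close>

lemma dvd_qnorm_iff: "p dvd qnorm a \<longleftrightarrow> p dvd fst a \<and> p dvd snd a"
proof
  assume h: "p dvd qnorm a"
  obtain x y where a: "a = (x, y)" by (cases a)
  have h: "p dvd x\<^sup>2 - u * x * y + v * y\<^sup>2" using h by (simp add: qnorm_def a)
  have y: "p dvd y"
  proof (rule ccontr)
    assume "\<not> p dvd y"
    then have "coprime y p" using p by (simp add: prime_imp_coprime coprime_commute)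
    then obtain z where z: "[y * z = 1] (mod p)" using cong_solve_coprime_int by blast
    have "[(- (x * z))\<^sup>2 + u * (- (x * z)) + v = x\<^sup>2 * z\<^sup>2 - u * x * z * (y * z) + v * (y * z)\<^sup>2] (mod p)"
    proof -
      have "[x\<^sup>2 * z\<^sup>2 - u * x * z * (y * z) + v * (y * z)\<^sup>2 = x\<^sup>2 * z\<^sup>2 - u * x * z * 1 + v * 1\<^sup>2] (mod p)"
        by (intro cong_add cong_diff cong_mult cong_pow cong_refl z)
      then show ?thesis by (simp add: cong_sym_eq power_mult_distrib mult.assoc)
    qed
    moreover have "x\<^sup>2 * z\<^sup>2 - u * x * z * (y * z) + v * (y * z)\<^sup>2 = (x\<^sup>2 - u * x * y + v * y\<^sup>2) * z\<^sup>2"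
      by (simp add: power2_eq_square algebra_simps)
    ultimately have "p dvd (- (x * z))\<^sup>2 + u * (- (x * z)) + v" using h by (simp add: cong_dvd_iff)
    with irred show False by blast
  qed
  then have "p dvd (x\<^sup>2 - u * x * y + v * y\<^sup>2) - (v * y\<^sup>2 - u * x * y)" using h
    by (intro dvd_diff) (auto simp: power2_eq_square)
  then have "p dvd x\<^sup>2" by simp
  then have "p dvd x" using p prime_dvd_power by blast
  with y show "p dvd fst a \<and> p dvd snd a" by (simp add: a)
qed (auto simp: qnorm_def power2_eq_square)

lemma qred_eq_iff: "qred a = qred b \<longleftrightarrow> [fst a = fst b] (mod p) \<and> [snd a = snd b] (mod p)"
  by (auto simp: qred_def cong_def)

lemma qred_qmul: "qred (qmul (qred a) b) = qred (qmul a b)" "qred (qmul a (qred b)) = qred (qmul a b)"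
proof -
  have [simp]: "[fst (qred x) = fst x] (mod p)" "[snd (qred x) = snd x] (mod p)" for x
    by (simp_all add: qred_def cong_def)
  show "qred (qmul (qred a) b) = qred (qmul a b)" "qred (qmul a (qred b)) = qred (qmul a b)"
    unfolding qred_eq_iff qmul_def fst_conv snd_conv
    by (intro conjI cong_add cong_diff cong_mult cong_refl; simp)+
qed

lemma qred_qadd: "qred (qadd (qred a) b) = qred (qadd a b)" "qred (qadd a (qred b)) = qred (qadd a b)"
  by (simp_all add: qred_def qadd_def mod_simps)

lemma field_Q: "field Q"
proof -
  have red: "qred a \<in> {0..<p} \<times> {0..<p}" for a using p_gt_1 by (simp add: qred_def)
  have id: "qred a = a" if "a \<in> {0..<p} \<times> {0..<p}" for a using that by (auto simp: qred_def)
  have "cring Q"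
  proof (rule cringI)
    show "abelian_group Q"
    proof (rule abelian_groupI)
      fix x y z assume x: "x \<in> carrier Q" and y: "y \<in> carrier Q" and "z \<in> carrier Q"
      show "x \<oplus>\<^bsub>Q\<^esub> y \<in> carrier Q" using red by (simp add: Q_def)
      show "x \<oplus>\<^bsub>Q\<^esub> y \<oplus>\<^bsub>Q\<^esub> z = x \<oplus>\<^bsub>Q\<^esub> (y \<oplus>\<^bsub>Q\<^esub> z)"
        by (simp add: Q_def qred_qadd) (simp add: qadd_def add.assoc)
      show "x \<oplus>\<^bsub>Q\<^esub> y = y \<oplus>\<^bsub>Q\<^esub> x" by (simp add: Q_def qadd_def add.commute)
      show "\<zero>\<^bsub>Q\<^esub> \<oplus>\<^bsub>Q\<^esub> x = x" using id[of x] x by (simp add: Q_def qadd_def)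
      show "\<exists>y\<in>carrier Q. y \<oplus>\<^bsub>Q\<^esub> x = \<zero>\<^bsub>Q\<^esub>"
      proof (rule bexI)
        show "qred (- fst x, - snd x) \<oplus>\<^bsub>Q\<^esub> x = \<zero>\<^bsub>Q\<^esub>"
          by (simp add: Q_def qred_qadd) (simp add: qadd_def qred_def)
        show "qred (- fst x, - snd x) \<in> carrier Q" using red by (simp add: Q_def)
      qed
    qed (use p_gt_1 in \<open>simp add: Q_def\<close>)
    show "Group.comm_monoid Q"
    proof (rule comm_monoidI)
      fix x y z assume x: "x \<in> carrier Q" and "y \<in> carrier Q" and "z \<in> carrier Q"
      show "x \<otimes>\<^bsub>Q\<^esub> y \<in> carrier Q" using red by (simp add: Q_def)
      show "x \<otimes>\<^bsub>Q\<^esub> y \<otimes>\<^bsub>Q\<^esub> z = x \<otimes>\<^bsub>Q\<^esub> (y \<otimes>\<^bsub>Q\<^esub> z)"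
        by (simp add: Q_def qred_qmul) (simp add: qmul_def algebra_simps)
      show "x \<otimes>\<^bsub>Q\<^esub> y = y \<otimes>\<^bsub>Q\<^esub> x" by (simp add: Q_def qmul_def algebra_simps)
      show "\<one>\<^bsub>Q\<^esub> \<otimes>\<^bsub>Q\<^esub> x = x" using id[of x] x by (simp add: Q_def qmul_def)
    qed (use p_gt_1 in \<open>simp add: Q_def\<close>)
    fix x y z assume "x \<in> carrier Q" "y \<in> carrier Q" "z \<in> carrier Q"
    show "(x \<oplus>\<^bsub>Q\<^esub> y) \<otimes>\<^bsub>Q\<^esub> z = x \<otimes>\<^bsub>Q\<^esub> z \<oplus>\<^bsub>Q\<^esub> y \<otimes>\<^bsub>Q\<^esub> z"
      by (simp add: Q_def qred_qmul qred_qadd) (simp add: qadd_def qmul_def algebra_simps)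
  qed
  then show ?thesis
  proof (rule cring.cring_fieldI2)
    show "\<zero>\<^bsub>Q\<^esub> \<noteq> \<one>\<^bsub>Q\<^esub>" by (simp add: Q_def)
    fix a assume a: "a \<in> carrier Q" "a \<noteq> \<zero>\<^bsub>Q\<^esub>"
    have "\<not> p dvd qnorm a"
    proof
      assume "p dvd qnorm a"
      then have "p dvd fst a" "p dvd snd a" by (auto simp: dvd_qnorm_iff)
      then have "fst a = 0" "snd a = 0" using a(1) by (auto simp: Q_def zdvd_not_zless dest: zdvd_imp_le)
      then show False using a(2) by (simp add: Q_def prod_eq_iff)
    qed
    then have "coprime (qnorm a) p" using p by (simp add: prime_imp_coprime coprime_commute)
    then obtain z where z: "[qnorm a * z = 1] (mod p)" using cong_solve_coprime_int by blast
    \<comment> \<open>The inverse is the conjugate of \<open>a\<close> divided by its norm; the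
      conjugate of \<open>X\<close> is \<open>- u - X\<close>.\<close>
    define b where "b = ((fst a - u * snd a) * z, - snd a * z)"
    have "qmul a b = (qnorm a * z, 0)"
      by (simp add: qmul_def b_def qnorm_def power2_eq_square algebra_simps)
    then have "qred (qmul a b) = (1, 0)" using z p_gt_1 by (simp add: qred_def cong_def)
    then show "\<exists>b\<in>carrier Q. a \<otimes>\<^bsub>Q\<^esub> b = \<one>\<^bsub>Q\<^esub>"
      by (intro bexI[of _ "qred b"]) (use red in \<open>auto simp: Q_def qred_qmul\<close>)
  qed
qed

text \<open>The unit group of a finite field is cyclic. With \<open>g\<close> a generator, some
  power of \<open>g\<close> equals the quotient of \<open>b\<close> by \<open>a\<close>.\<close>

lemma ex_transitive_multiplication:
  "\<exists>g. \<not> p dvd qnorm g \<and> (\<forall>a b. qred a \<noteq> (0, 0) \<longrightarrow> qred b \<noteq> (0, 0) \<longrightarrow>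
     (\<exists>i::nat. qred ((qmul g ^^ i) a) = qred b))"
proof -
  interpret field Q by (rule field_Q)
  have fin: "finite (carrier Q)" by (simp add: Q_def)
  obtain g where g: "g \<in> carrier (mult_of Q)" "carrier (mult_of Q) = {g [^]\<^bsub>mult_of Q\<^esub> i | i::nat. i \<in> UNIV}"
    using finite_field_mult_group_has_gen[OF fin] unfolding nat_pow_mult_of[symmetric] by blast
  have gQ: "g \<in> carrier Q" "g \<noteq> (0, 0)" using g(1) by (auto simp: mult_of_def Q_def)
  have zero: "qred a = (0, 0) \<longleftrightarrow> p dvd fst a \<and> p dvd snd a" for a by (auto simp: qred_def)
  have "qred g = g" using gQ by (auto simp: Q_def qred_def)
  then have "\<not> p dvd qnorm g" using gQ(2) zero[of g] dvd_qnorm_iff[of g] by simp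
  moreover have "\<exists>i::nat. qred ((qmul g ^^ i) a) = qred b" if "qred a \<noteq> (0, 0)" "qred b \<noteq> (0, 0)" for a b
  proof -
    have ab: "qred a \<in> carrier (mult_of Q)" "qred b \<in> carrier (mult_of Q)"
      using that p_gt_1 by (auto simp: mult_of_def Q_def qred_def)
    interpret G: Group.group "mult_of Q" by (rule field_mult_group)
    have "qred b \<otimes>\<^bsub>mult_of Q\<^esub> inv\<^bsub>mult_of Q\<^esub> (qred a) \<in> carrier (mult_of Q)"
      using ab G.m_closed G.inv_closed by blast
    then obtain i :: nat where i: "qred b \<otimes>\<^bsub>mult_of Q\<^esub> inv\<^bsub>mult_of Q\<^esub> (qred a) = g [^]\<^bsub>mult_of Q\<^esub> i"
      using g(2) by blast
    have pow: "qred ((qmul g ^^ i) a) = g [^]\<^bsub>mult_of Q\<^esub> i \<otimes>\<^bsub>mult_of Q\<^esub> qred a" for i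
    proof (induction i)
      case 0
      show ?case using G.l_one[OF ab(1)] by simp
    next
      case (Suc i)
      have "g [^]\<^bsub>mult_of Q\<^esub> Suc i \<otimes>\<^bsub>mult_of Q\<^esub> qred a
        = g \<otimes>\<^bsub>mult_of Q\<^esub> (g [^]\<^bsub>mult_of Q\<^esub> i \<otimes>\<^bsub>mult_of Q\<^esub> qred a)"
        unfolding G.nat_pow_Suc2[OF g(1)] by (rule G.m_assoc[OF g(1) G.nat_pow_closed[OF g(1)] ab(1)])
      also have "\<dots> = qred (qmul g (qred ((qmul g ^^ i) a)))"
        unfolding Suc[symmetric] by (simp add: Q_def)
      finally show ?case by (simp add: qred_qmul)
    qed
    have "qred ((qmul g ^^ i) a) = qred b"
      unfolding pow i[symmetric] using G.m_assoc[OF ab(2) G.inv_closed[OF ab(1)] ab(1)]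
        G.l_inv[OF ab(1)] G.r_one[OF ab(2)] by simp
    then show ?thesis ..
  qed
  ultimately show ?thesis by blast
qed

end

section \<open>Lifting to an expanding integer matrix\<close>

text \<open>
  Off-diagonal entries of opposite sign and large product make the discriminant negative and the determinant
  large, so both eigenvalues have modulus \<open>sqrt (det N)\<close>.
\<close>

lemma ex_expanding_lift:
  fixes G :: "int ^ 2 ^ 2" and p :: int
  assumes p: "p > 0"
  shows "\<exists>N. (\<forall>i j. [N $ i $ j = G $ i $ j] (mod p)) \<and> expanding (real_mat (transpose N))"
proof -
  define a d where "a = G $ 1 $ 1" and "d = G $ 2 $ 2"
  \<comment> \<open>If \<open>- (b * c)\<close> is at least \<open>R\<close>, the square makes the
    discriminant negative, and the other terms push \<open>a * d - b * c\<close> above 1.\<close>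
  define R where "R = (a - d)\<^sup>2 + \<bar>a * d\<bar> + 2"
  \<comment> \<open>Only multiples of \<open>p\<close> are added: \<open>b\<close> becomes positive,
    and the extra \<open>- 1\<close> in \<open>c\<close> absorbs the residue, so that
    \<open>- c\<close> is at least \<open>R\<close>.\<close>
  define b c where "b = G $ 1 $ 2 mod p + p" and "c = G $ 2 $ 1 mod p + p * (- R - 1)"
  define N :: "int ^ 2 ^ 2" where "N = vector [vector [a, b], vector [c, d]]"
  have N: "N $ 1 $ 1 = a" "N $ 1 $ 2 = b" "N $ 2 $ 1 = c" "N $ 2 $ 2 = d"
    by (simp_all add: N_def)
  have R: "R \<ge> 2" by (simp add: R_def)
  have "b \<ge> 1" using p by (simp add: b_def add_increasing)
  moreover have "- c \<ge> R"
  proof -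
    have "G $ 2 $ 1 mod p < p" using p by simp
    moreover have "p * R \<ge> R" using p R by simp
    ultimately show ?thesis by (simp add: c_def algebra_simps)
  qed
  ultimately have "1 * R \<le> b * (- c)" using R by (intro mult_mono) auto
  then have bc: "R \<le> - (b * c)" by simp
  have det: "det N = a * d - b * c" by (simp add: det_2 N)
  have "det N > 1" using bc unfolding det R_def by (smt (verit) zero_le_power2)
  moreover have "(a + d)\<^sup>2 < 4 * det N"
  proof -
    have "(a + d)\<^sup>2 = (a - d)\<^sup>2 + 4 * (a * d)" by (simp add: power2_eq_square algebra_simps)
    moreover have "(a - d)\<^sup>2 < R" by (simp add: R_def)
    ultimately show ?thesis using bc R unfolding det by simp
  qed
  moreover have e: "det (real_mat (transpose N)) = real_of_int (det N)"
    "real_mat (transpose N) $ 1 $ 1 + real_mat (transpose N) $ 2 $ 2 = real_of_int (a + d)"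
    by (simp_all add: det_2 map_matrix_def transpose_def N)
  ultimately have "expanding (real_mat (transpose N))"
    by (intro expanding_of_neg_discriminant; unfold e; linarith?)
      (metis of_int_less_iff of_int_mult of_int_numeral of_int_power)
  moreover have "[N $ i $ j = G $ i $ j] (mod p)" for i j
    using exhaust_2[of i] exhaust_2[of j]
    by (auto simp: N a_def b_def c_def d_def cong_def mod_simps)
  ultimately show ?thesis by blast
qed

text \<open>The lift changes entries only by multiples of \<open>p\<close>, so both the determinant
  and the action on residue vectors are those of multiplication by the generator.\<close>

lemma ex_transitive_expanding_matrix:
  fixes p :: nat
  assumes p: "prime p"
  shows "\<exists>N :: int ^ 2 ^ 2. expanding (real_mat (transpose N)) \<and> coprime (det N) (int p) \<and>
    (\<forall>v w. \<not> zero_mod p v \<longrightarrow> \<not> zero_mod p w \<longrightarrow> (\<exists>i. zero_mod p (((*v) N ^^ i) v - w)))"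
proof -
  have p': "prime (int p)" using p by simp
  obtain s t where "\<And>x. \<not> int p dvd x\<^sup>2 + s * x + t" using ex_irreducible_quadratic_mod[OF p'] by blast
  then interpret quadratic_extension "int p" s t by unfold_locales (use p' in auto)
  obtain g where g: "\<not> int p dvd qnorm g"
    and trans: "\<And>a b. qred a \<noteq> (0, 0) \<Longrightarrow> qred b \<noteq> (0, 0) \<Longrightarrow> \<exists>i::nat. qred ((qmul g ^^ i) a) = qred b"
    using ex_transitive_multiplication by blast
  \<comment> \<open>The columns are \<open>g\<close> and \<open>g X\<close> in the basis 1,
    \<open>X\<close>; hence the determinant is the norm of \<open>g\<close>.\<close>
  define G :: "int ^ 2 ^ 2" where
    "G = vector [vector [fst g, - t * snd g], vector [snd g, fst g - s * snd g]]"
  have G: "G $ 1 $ 1 = fst g" "G $ 1 $ 2 = - t * snd g" "G $ 2 $ 1 = snd g" "G $ 2 $ 2 = fst g - s * snd g"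
    by (simp_all add: G_def)
  have "int p > 0" using p' prime_gt_0_int by blast
  then obtain N where N: "\<And>i j. [N $ i $ j = G $ i $ j] (mod int p)" "expanding (real_mat (transpose N))"
    using ex_expanding_lift by blast
  have "[det N = det G] (mod int p)" unfolding det_2 by (intro cong_diff cong_mult N)
  moreover have "det G = qnorm g"
    by (simp add: det_2 G qnorm_def power2_eq_square algebra_simps)
  ultimately have "\<not> int p dvd det N" using g by (simp add: cong_dvd_iff)
  then have cop: "coprime (det N) (int p)"
    using p' prime_imp_coprime coprime_commute by blast
  define P where "P x = (x $ 1, x $ 2)" for x :: "int ^ 2"
  have P0: "qred (P x) = (0, 0) \<longleftrightarrow> zero_mod p x" for x
    by (auto simp: qred_def P_def zero_mod_def forall_2)
  have step: "qred (P (N *v x)) = qred (qmul g (P x))" for x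
  proof -
    have "P (G *v x) = qmul g (P x)"
      by (simp add: P_def qmul_def matrix_vector_mult_def sum_2 G algebra_simps)
    moreover have "[(N *v x) $ i = (G *v x) $ i] (mod int p)" for i
      unfolding matrix_vector_mult_def sum_2 vec_lambda_beta by (intro cong_add cong_mult N cong_refl)
    ultimately show ?thesis by (metis (no_types, lifting) P_def qred_eq_iff fst_conv snd_conv)
  qed
  have pow: "qred (P (((*v) N ^^ i) x)) = qred ((qmul g ^^ i) (P x))" for i x
  proof (induction i)
    case (Suc i)
    then show ?case using step[of "((*v) N ^^ i) x"] by (simp, metis qred_qmul(2))
  qed simp
  have "\<exists>i. zero_mod p (((*v) N ^^ i) v - w)" if vw: "\<not> zero_mod p v" "\<not> zero_mod p w" for v w
  proof -
    obtain i where "qred ((qmul g ^^ i) (P v)) = qred (P w)"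
      using trans[of "P v" "P w"] vw by (auto simp: P0)
    then have "qred (P (((*v) N ^^ i) v)) = qred (P w)" by (simp add: pow)
    then have "zero_mod p (((*v) N ^^ i) v - w)"
      by (simp add: qred_eq_iff P_def zero_mod_def forall_2 cong_iff_dvd_diff)
    then show ?thesis ..
  qed
  with N(2) cop show ?thesis by blast
qed

section \<open>Sharpness\<close>

lemma funpow_matrix_diff:
  fixes N :: "int ^ 'n ^ 'n"
  shows "((*v) N ^^ i) (v - w) = ((*v) N ^^ i) v - ((*v) N ^^ i) w"
proof (induction i)
  case (Suc i)
  then show ?case by (simp add: matrix_vector_mult_diff_distrib)
qed simp

text \<open>Transitivity moves each difference of residues to the numerator of one known mask zero.
  A common exponent \<open>K\<close> beyond all these times makes the \<open>B\<close>-orbit of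
  every frequency difference meet a translate of that zero.\<close>

lemma (in integer_self_affine) ex_orthogonal_exps:
  assumes p: "prime p" and z: "z \<in> Z_set D" and Z: "Z_set D \<subseteq> E_ring p"
    and trans: "\<And>v w. \<not> zero_mod p v \<Longrightarrow> \<not> zero_mod p w \<Longrightarrow>
       \<exists>i. zero_mod p (((*v) (transpose M) ^^ i) v - w)"
  shows "\<exists>\<Lambda>. finite \<Lambda> \<and> card \<Lambda> = p\<^sup>2 \<and> mutually_orthogonal_exps \<mu> \<Lambda>"
proof -
  have p0: "p > 0" using p prime_gt_0_nat by blast
  have "mask D z = 0" using z by (simp add: Z_set_def)
  then obtain l where l: "z = (1 / real p) *\<^sub>R real_vec l" "\<not> zero_mod p l"
    using mask_zero_in_lattice[OF p0 Z] by blast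
  define V where "V = (\<lambda>(x, y). vector [x, y] :: int ^ 2) ` ({0..<int p} \<times> {0..<int p})"
  have "inj_on (\<lambda>(x, y). vector [x, y] :: int ^ 2) ({0..<int p} \<times> {0..<int p})"
    by (auto simp: inj_on_def vec_eq_iff forall_2)
  then have V: "finite V" "card V = p\<^sup>2"
    by (simp_all add: V_def card_image card_cartesian_product power2_eq_square)
  have V_diff: "\<not> zero_mod p (v - w)" if "v \<in> V" "w \<in> V" "v \<noteq> w" for v w
  proof
    assume "zero_mod p (v - w)"
    then have "v $ i mod int p = w $ i mod int p" for i by (simp add: zero_mod_def mod_eq_dvd_iff)
    moreover have "x $ i mod int p = x $ i" if "x \<in> V" for x i
      using that exhaust_2[of i] by (auto simp: V_def)
    ultimately have "v = w" using that by (simp add: vec_eq_iff)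
    with that show False by simp
  qed
  have ex: "\<forall>v. \<exists>i. \<not> zero_mod p v \<longrightarrow> zero_mod p (((*v) (transpose M) ^^ i) v - l)"
    using trans[OF _ l(2)] by blast
  from choice[OF ex] obtain I where
    I: "\<forall>v. \<not> zero_mod p v \<longrightarrow> zero_mod p (((*v) (transpose M) ^^ I v) v - l)" ..
  \<comment> \<open>The \<open>Suc\<close> keeps \<open>K - I (v - w)\<close> positive, as only
    positive powers of \<open>B\<close> count in the criterion for zeros.\<close>
  define K where "K = Suc (Max (I ` (\<lambda>(v, w). v - w) ` (V \<times> V)))"
  have K: "I (v - w) < K" if "v \<in> V" "w \<in> V" for v w
    unfolding K_def less_Suc_eq_le using that V(1) by (intro Max_ge) auto
  define e where "e v = (1 / real p) *\<^sub>R real_vec (((*v) (transpose M) ^^ K) v)" for v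
  have orth: "fourier \<mu> (e v - e w) = 0" if vw: "v \<in> V" "w \<in> V" "v \<noteq> w" for v w
  proof -
    define x where "x = ((*v) (transpose M) ^^ I (v - w)) (v - w)"
    have "zero_mod p (x - l)" unfolding x_def by (rule I[rule_format, OF V_diff[OF vw]])
    then obtain k where k: "\<And>i. x $ i - l $ i = int p * k i"
      unfolding zero_mod_def dvd_def by (simp del: vector_minus_component add: vector_minus_component[symmetric]) metis
    define k' :: "int ^ 2" where "k' = vec_lambda k"
    have "x = l + int p *s k'" using k by (simp add: vec_eq_iff k'_def algebra_simps)
    then have "(1 / real p) *\<^sub>R real_vec x = z + real_vec k'"
      using p0 by (simp add: l(1) real_vec_add real_vec_smult scaleR_add_right)
    then have "mask D ((1 / real p) *\<^sub>R real_vec x) = 0"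
      using \<open>mask D z = 0\<close> by (simp add: mask_periodic)
    moreover have "((*v) B ^^ (K - I (v - w))) (e v - e w) = (1 / real p) *\<^sub>R real_vec x"
    proof -
      have "e v - e w = (1 / real p) *\<^sub>R real_vec (((*v) (transpose M) ^^ K) (v - w))"
        unfolding e_def funpow_matrix_diff real_vec_diff by (simp only: scaleR_diff_right)
      also have "K = (K - I (v - w)) + I (v - w)" using K[OF vw(1,2)] by simp
      also have "((*v) (transpose M) ^^ \<dots>) (v - w) = ((*v) (transpose M) ^^ (K - I (v - w))) x"
        unfolding x_def funpow_add comp_apply ..
      finally show ?thesis using B_pow_integer by metis
    qed
    moreover obtain n where "K - I (v - w) = Suc n"
      using K[OF vw(1,2)] by (metis Suc_pred' zero_less_diff)
    ultimately show ?thesis unfolding fourier_eq_0_iff by metis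
  qed
  \<comment> \<open>Coinciding frequencies would make the transform vanish at 0, where its value is
    1.\<close>
  have "inj_on e V"
  proof (rule inj_onI, rule ccontr)
    fix v w assume vw: "v \<in> V" "w \<in> V" "e v = e w" "v \<noteq> w"
    then have "fourier \<mu> 0 = 0" using orth[of v w] by simp
    then show False by (simp add: fourier_def exp_fun_def prob_space)
  qed
  then have "finite (e ` V)" "card (e ` V) = p\<^sup>2" using V by (simp_all add: card_image)
  moreover have "mutually_orthogonal_exps \<mu> (e ` V)"
    unfolding mutually_orthogonal_exps_def pairwise_def L2_inner_exp_fun using orth by auto
  ultimately show ?thesis by blast
qed

text \<open>The mask of the empty digit set is 0 everywhere, in particular at the origin, which
  \<open>E_ring p\<close> omits. The hypothesis on zeros thus supplies the nonempty digit set that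
  the locale asks for.\<close>

lemma Z_set_empty_digits: "Z_set {} \<subseteq> E_ring p \<Longrightarrow> False"
proof -
  assume "Z_set {} \<subseteq> E_ring p"
  moreover have "(0 :: real ^ 2) \<in> Z_set {}" by (simp add: Z_set_def mask_def)
  ultimately show False by (auto simp: E_ring_def)
qed

theorem theorem1p1:
  fixes p :: nat
  assumes "p \<ge> 2"
  shows "(\<forall>(D :: (int ^ 2) set) (M :: int ^ 2 ^ 2) (\<Lambda> :: (real ^ 2) set).
            finite D \<longrightarrow> expanding (real_mat M) \<longrightarrow>
            Z_set D \<noteq> {} \<longrightarrow> Z_set D \<subseteq> E_ring p \<longrightarrow> gcd (det M) (int p) = 1 \<longrightarrow>
            mutually_orthogonal_exps (self_affine_measure (real_mat M) (real_vec ` D)) \<Lambda> \<longrightarrow>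
            finite \<Lambda> \<and> card \<Lambda> \<le> p\<^sup>2)
       \<and> (prime p \<longrightarrow>
            (\<forall>D :: (int ^ 2) set.
               finite D \<longrightarrow> Z_set D \<noteq> {} \<longrightarrow> Z_set D \<subseteq> E_ring p \<longrightarrow>
               (\<exists>M :: int ^ 2 ^ 2. expanding (real_mat M) \<and> gcd (det M) (int p) = 1 \<and>
                  (\<exists>\<Lambda> :: (real ^ 2) set. finite \<Lambda> \<and> card \<Lambda> = p\<^sup>2 \<and>
                     mutually_orthogonal_exps
                       (self_affine_measure (real_mat M) (real_vec ` D)) \<Lambda>))))"
proof (intro conjI allI impI)
  fix D :: "(int ^ 2) set" and M :: "int ^ 2 ^ 2" and \<Lambda> :: "(real ^ 2) set"
  assume D: "finite D" and M: "expanding (real_mat M)" and Z: "Z_set D \<subseteq> E_ring p"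
    and gcd: "gcd (det M) (int p) = 1"
    and orth: "mutually_orthogonal_exps (self_affine_measure (real_mat M) (real_vec ` D)) \<Lambda>"
  interpret integer_self_affine M D
    by unfold_locales (use D M Z Z_set_empty_digits in auto)
  have "\<exists>l. a - b = (1 / real p) *\<^sub>R real_vec l \<and> \<not> zero_mod p l"
    if "a \<in> \<Lambda>" "b \<in> \<Lambda>" "a \<noteq> b" for a b
  proof (rule fourier_zero_in_lattice[OF _ Z])
    show "fourier \<mu> (a - b) = 0"
      using orth that by (auto simp: mutually_orthogonal_exps_def pairwise_def L2_inner_exp_fun \<mu>_def)
  qed (use gcd assms in \<open>simp_all add: coprime_iff_gcd_eq_1\<close>)
  then have "finite \<Lambda> \<and> card \<Lambda> \<le> p\<^sup>2"
    using assms by (intro card_le_of_lattice_differences) auto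
  then show "finite \<Lambda>" "card \<Lambda> \<le> p\<^sup>2" by auto
next
  fix D :: "(int ^ 2) set"
  assume p: "prime p" and fin: "finite D" and ne: "Z_set D \<noteq> {}" and Z: "Z_set D \<subseteq> E_ring p"
  obtain N :: "int ^ 2 ^ 2" where N: "expanding (real_mat (transpose N))" "coprime (det N) (int p)"
    and trans: "\<And>v w. \<not> zero_mod p v \<Longrightarrow> \<not> zero_mod p w \<Longrightarrow> \<exists>i. zero_mod p (((*v) N ^^ i) v - w)"
    using ex_transitive_expanding_matrix[OF p] by blast
  \<comment> \<open>Frequencies are moved by the transpose of the matrix, so the transpose of
    \<open>N\<close> is chosen to make them move by \<open>N\<close>.\<close>
  interpret integer_self_affine "transpose N" D
    by unfold_locales (use fin N Z Z_set_empty_digits in auto)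
  obtain z where "z \<in> Z_set D" using ne by blast
  then have orth: "\<exists>\<Lambda>. finite \<Lambda> \<and> card \<Lambda> = p\<^sup>2 \<and> mutually_orthogonal_exps \<mu> \<Lambda>"
    by (rule ex_orthogonal_exps[OF p _ Z]) (use trans in \<open>simp only: transpose_transpose\<close>)
  show "\<exists>M :: int ^ 2 ^ 2. expanding (real_mat M) \<and> gcd (det M) (int p) = 1 \<and>
      (\<exists>\<Lambda>. finite \<Lambda> \<and> card \<Lambda> = p\<^sup>2 \<and>
        mutually_orthogonal_exps (self_affine_measure (real_mat M) (real_vec ` D)) \<Lambda>)"
  proof (intro exI[of _ "transpose N"] conjI)
    show "gcd (det (transpose N)) (int p) = 1" using N(2) by (simp add: det_transpose)
  qed (use N(1) orth[unfolded \<mu>_def] in auto)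
qed

end
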